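(* For every $f\in{\cal N}_1$ there is $C<\infty$ such that $\int_0^{2\pi}\big|\log|f(c+re^{i\theta})|\big|\,d\theta<C$ for all $c\in\mathbb{C}$ and all $r>1$.
   Context: $\rho_S$ is the spherical metric. A meromorphic $f$ on $\mathbb{C}$ is normal if every sequence of translates $f(z+h_n)$ has a subsequence Cauchy in $\rho_S$ uniformly on compacta; $f\in{\cal N}_1$ if moreover no limit of translates is a constant function (including $\infty$). *)

theory Defs
  imports "HOL-Analysis.Analysis"
begin

text \<open>The Riemann sphere is modelled as complex option; None is the point at infinity.\<close>

fun sph_dist :: "complex option \<Rightarrow> complex option \<Rightarrow> real" where
  "sph_dist (Some a) (Some b) =
     2 * cmod (a - b) / sqrt ((1 + (cmod a)\<^sup>2) * (1 + (cmod b)\<^sup>2))"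
| "sph_dist (Some a) None = 2 / sqrt (1 + (cmod a)\<^sup>2)"
| "sph_dist None (Some b) = 2 / sqrt (1 + (cmod b)\<^sup>2)"
| "sph_dist None None = 0"

definition meromorphic_C :: "(complex \<Rightarrow> complex option) \<Rightarrow> bool" where
  "meromorphic_C f \<longleftrightarrow>
     (\<forall>z. \<exists>e>0. \<forall>w\<in>ball z e - {z}. f w \<noteq> None) \<and>
     (\<lambda>z. the (f z)) holomorphic_on {z. f z \<noteq> None} \<and>
     (\<forall>p. f p = None \<longrightarrow> filterlim (\<lambda>z. the (f z)) at_infinity (at p))"

definition loc_unif_cauchy_sph :: "(nat \<Rightarrow> complex \<Rightarrow> complex option) \<Rightarrow> bool" where
  "loc_unif_cauchy_sph F \<longleftrightarrow>
     (\<forall>K. compact K \<longrightarrow> (\<forall>\<epsilon>>0. \<exists>N. \<forall>m\<ge>N. \<forall>n\<ge>N. \<forall>z\<in>K. sph_dist (F m z) (F n z) < \<epsilon>))"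

definition loc_unif_conv_sph ::
    "(nat \<Rightarrow> complex \<Rightarrow> complex option) \<Rightarrow> (complex \<Rightarrow> complex option) \<Rightarrow> bool" where
  "loc_unif_conv_sph F g \<longleftrightarrow>
     (\<forall>K. compact K \<longrightarrow> (\<forall>\<epsilon>>0. \<exists>N. \<forall>n\<ge>N. \<forall>z\<in>K. sph_dist (F n z) (g z) < \<epsilon>))"

definition normal_mero :: "(complex \<Rightarrow> complex option) \<Rightarrow> bool" where
  "normal_mero f \<longleftrightarrow> meromorphic_C f \<and>
     (\<forall>h::nat \<Rightarrow> complex. \<exists>s. strict_mono s \<and> loc_unif_cauchy_sph (\<lambda>n z. f (z + h (s n))))"

definition N1 :: "(complex \<Rightarrow> complex option) \<Rightarrow> bool" where
  "N1 f \<longleftrightarrow> normal_mero f \<and>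
     \<not> (\<exists>(h::nat \<Rightarrow> complex) (c::complex option). loc_unif_conv_sph (\<lambda>n z. f (z + h n)) (\<lambda>_. c))"

fun abs_log_abs :: "complex option \<Rightarrow> ennreal" where
  "abs_log_abs None = \<infinity>"
| "abs_log_abs (Some w) = (if w = 0 then \<infinity> else ennreal \<bar>ln (cmod w)\<bar>)"

end

theory Submission
  imports Defs "HOL-Complex_Analysis.Complex_Analysis"
begin

text \<open>Normality makes f uniformly spherically continuous, so on every disc of some fixed radius f or 1/f
is holomorphic and bounded by 4. As no limit of translates is constant, every such disc contains, near
its centre, a point at which f stays a fixed distance away from 0 and infinity. Dividing out the zeros
near that point (the growth of the quotient bounds their number) and applying Harnack's inequality to
the zero-free rest gives |log |f(z)|| \<le> C + \<Sum> log^+ (1/|z - a|) on a disc of fixed radius, with a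
bounded number of points a. Along an arc of bounded length of a circle of radius r > 1 this has bounded
integral with respect to arc length, hence O(1/r) with respect to the angle, and O(r) such arcs cover
the circle.\<close>

section \<open>Lower bounds for holomorphic functions in terms of their zeros\<close>

text \<open>The integrand is infinite at zeros and poles, and a circle may meet many of them, so no
  pointwise bound is available. What must not depend on the disc is the number of points
  \<open>a\<close> and the additive constant; both are controlled by the ratio of the upper bound 4
  to a lower bound at a single point. That lower bound is the crux, and it comes from compactness: f
  cannot cling to {0, infinity} on discs of a fixed radius. Normality supplies Cauchy sequences of
  translates rather than limit functions. Holomorphic limits are therefore formed only locally,
  where the translates are finite and bounded, and connectedness carries the conclusion to the whole
  plane. Inversion is an isometry exchanging 0 and infinity, so that only zeros ever have to be
  divided out.\<close>

text \<open>Harnack's inequality for the positive harmonic function log(M/|u|): for |z| < 1/2 its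
  value is at most (1 + 1/2)/(1 - 1/2) = 3 times the value at 0, and exponentiating gives |u(z)|/M
  >= (|u(0)|/M)^3.\<close>

lemma harnack_nonvanishing_unit:
  fixes u :: "complex \<Rightarrow> complex"
  assumes hol: "u holomorphic_on ball 0 1" and nz: "\<And>z. z \<in> ball 0 1 \<Longrightarrow> u z \<noteq> 0"
    and bd: "\<And>z. z \<in> ball 0 1 \<Longrightarrow> cmod (u z) < M" and z: "cmod z < 1/2"
  shows "cmod (u 0) ^ 3 / M\<^sup>2 \<le> cmod (u z)"
proof -
  obtain g where g: "g holomorphic_on ball 0 1" and ug: "\<And>z. z \<in> ball 0 1 \<Longrightarrow> u z = exp (g z)"
    by (rule contractible_imp_holomorphic_log[OF hol _ nz]) (auto intro: convex_imp_contractible)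
  have M: "M > 0" using bd[of 0] by (smt (verit) centre_in_ball norm_ge_zero zero_less_one)
  \<comment> \<open>\<open>w = log (M/u)\<close> maps into the right half-plane; the Cayley transform makes it a Schwarz function.\<close>
  define w where "w = (\<lambda>z. of_real (ln M) - g z + \<i> * of_real (Im (g 0)))"
  have norm_u: "cmod (u z) = M * exp (- Re (w z))" if "z \<in> ball 0 1" for z
    using ug[OF that] M by (simp add: w_def exp_diff)
  have Rew: "Re (w z) > 0" if "z \<in> ball 0 1" for z
    using bd[OF that] norm_u[OF that] M by (simp)
  define a where "a = Re (w 0)"
  \<comment> \<open>The imaginary constant in \<open>w\<close> serves this: with \<open>w 0\<close>
    real, \<open>\<phi>\<close> fixes 0, as the Schwarz lemma requires.\<close>
  have w0: "w 0 = of_real a" by (simp add: a_def w_def complex_eq_iff)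
  have a: "a > 0" using Rew[of 0] a_def by simp
  have wa: "w z + of_real a \<noteq> 0" if "z \<in> ball 0 1" for z
    using Rew[OF that] a by (auto simp: complex_eq_iff)
  define \<phi> where "\<phi> = (\<lambda>z. (w z - of_real a) / (w z + of_real a))"
  have "w holomorphic_on ball 0 1" unfolding w_def by (intro holomorphic_intros g)
  then have hphi: "\<phi> holomorphic_on ball 0 1"
    unfolding \<phi>_def using wa by (intro holomorphic_intros) auto
  have "cmod (\<phi> z) < 1" if "cmod z < 1" for z
  proof -
    have "(cmod (w z - of_real a))\<^sup>2 < (cmod (w z + of_real a))\<^sup>2"
      using mult_pos_pos[of "Re (w z)" a] Rew[of z] a that
      unfolding cmod_power2 by (simp add: power2_eq_square algebra_simps)
    then have "cmod (w z - of_real a) < cmod (w z + of_real a)"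
      by (rule power_less_imp_less_base) simp
    then show ?thesis using wa[of z] that by (simp add: \<phi>_def norm_divide)
  qed
  then have "cmod (\<phi> z) \<le> cmod z"
    using Schwarz_Lemma(1)[OF hphi] z w0 by (simp add: \<phi>_def)
  then have p: "cmod (\<phi> z) \<le> 1/2" using z by simp
  have zb: "z \<in> ball 0 1" using z by simp
  \<comment> \<open>Inverting the Cayley transform gives w = a (1 + \<phi>)/(1 - \<phi>), and
    |\<phi>| <= 1/2 bounds the quotient by (3/2)/(1/2).\<close>
  have "cmod (w z) \<le> 3 * a"
  proof -
    have eq: "w z * (1 - \<phi> z) = of_real a * (1 + \<phi> z)"
      using wa[OF zb] by (simp add: \<phi>_def field_simps)
    have 1: "cmod (1 - \<phi> z) \<ge> 1/2" using norm_triangle_ineq2[of 1 "\<phi> z"] p by simp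
    have 2: "cmod (1 + \<phi> z) \<le> 3/2" using norm_triangle_ineq[of 1 "\<phi> z"] p by simp
    have "cmod (w z) * (1/2) \<le> cmod (w z) * cmod (1 - \<phi> z)" using 1 by (intro mult_left_mono) auto
    also have "\<dots> = a * cmod (1 + \<phi> z)" using arg_cong[OF eq, of cmod] a by (simp add: norm_mult)
    also have "\<dots> \<le> a * (3/2)" using 2 a by (intro mult_left_mono) auto
    finally show ?thesis by simp
  qed
  then have "Re (w z) \<le> 3 * a" using complex_Re_le_cmod[of "w z"] by linarith
  then have "M * exp (- (3 * a)) \<le> cmod (u z)" using norm_u[OF zb] M by simp
  moreover have "exp (- (3 * a)) = exp (- a) ^ 3" by (simp add: exp_of_nat_mult[symmetric])
  moreover have "cmod (u 0) = M * exp (- a)" using norm_u[of 0] a_def by simp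
  ultimately show ?thesis using M by (simp add: power_mult_distrib power2_eq_square power3_eq_cube mult_ac)
qed

lemma harnack_nonvanishing:
  fixes u :: "complex \<Rightarrow> complex"
  assumes hol: "u holomorphic_on ball 0 R" and nz: "\<And>z. z \<in> ball 0 R \<Longrightarrow> u z \<noteq> 0"
    and bd: "\<And>z. z \<in> ball 0 R \<Longrightarrow> cmod (u z) < M" and R: "R > 0" and z: "cmod z < R/2"
  shows "cmod (u 0) ^ 3 / M\<^sup>2 \<le> cmod (u z)"
proof -
  have sub: "of_real R * x \<in> ball 0 R" if "x \<in> ball 0 1" for x :: complex
    using that R by (simp add: norm_mult)
  have "(u \<circ> (\<lambda>x. of_real R * x)) holomorphic_on ball 0 1"
    by (rule holomorphic_on_compose_gen[OF _ hol]) (use sub in \<open>auto intro!: holomorphic_intros\<close>)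
  from harnack_nonvanishing_unit[OF this, of M "z / of_real R"] show ?thesis
    using sub nz bd z R by (simp add: norm_divide field_simps)
qed

text \<open>Dividing by \<open>z - a\<close> with \<open>|a| < 1/4\<close> multiplies the bound \<open>M\<close> on the unit circle by at most 4/3
and the lower bound \<open>m\<close> at 0 by at least 4, so \<open>M/m\<close> drops by the factor 3 with each zero removed.\<close>
lemma lower_bound_by_zeros:
  fixes F :: "complex \<Rightarrow> complex"
  assumes "F holomorphic_on ball 0 2" and "\<And>z. z \<in> cball 0 1 \<Longrightarrow> cmod (F z) \<le> M"
    and "m \<le> cmod (F 0)" and "0 < m" and "M < 3 ^ k * m"
  shows "\<exists>as. length as \<le> k \<and>
           (\<forall>z. cmod z < 1/8 \<longrightarrow> m ^ 3 / (2 * M)\<^sup>2 * (\<Prod>a\<leftarrow>as. cmod (z - a)) \<le> cmod (F z))"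
  using assms
proof (induction k arbitrary: F m M)
  \<comment> \<open>For k = 0 the last hypothesis reads M < m, against m <= |F(0)| <= M.\<close>
  case 0
  have "cmod (F 0) \<le> M" using "0.prems"(2)[of 0] by simp
  then show ?case using "0.prems"(3,5) by simp
next
  case (Suc k)
  have mM: "m \<le> M" using Suc.prems(2)[of 0] Suc.prems(3) by simp
  show ?case
  proof (cases "\<exists>a \<in> ball 0 (1/4). F a = 0")
    case False
    have "m ^ 3 / (2 * M)\<^sup>2 \<le> cmod (F z)" if "cmod z < 1/8" for z
    proof -
      \<comment> \<open>Doubling M yields the strict bound that \<open>harnack_nonvanishing\<close>
        asks for. Its radius 1/4 is halved there, whence the 1/8 in the claim.\<close>
      have "cmod (F z) < 2 * M" if "cmod z < 1/4" for z
        using Suc.prems(2)[of z] that mM Suc.prems(4) by simp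
      then have "cmod (F 0) ^ 3 / (2 * M)\<^sup>2 \<le> cmod (F z)"
        using False that
        by (intro harnack_nonvanishing[where R = "1/4"] holomorphic_on_subset[OF Suc.prems(1)]) auto
      moreover have "m ^ 3 / (2 * M)\<^sup>2 \<le> cmod (F 0) ^ 3 / (2 * M)\<^sup>2"
        using Suc.prems(3,4) by (intro divide_right_mono power_mono) auto
      ultimately show ?thesis by linarith
    qed
    then show ?thesis by (intro exI[of _ "[]"]) auto
  next
    case True
    then obtain a where a: "cmod a < 1/4" "F a = 0" by auto
    \<comment> \<open>\<open>u\<close> may vanish at \<open>a\<close> again; a multiple zero is then
      removed repeatedly, which is why the zeros form a list.\<close>
    define u where "u = (\<lambda>z. if z = a then deriv F a else (F z - F a) / (z - a))"
    have hu: "u holomorphic_on ball 0 2"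
      unfolding u_def by (rule pole_lemma[OF Suc.prems(1)]) (use a in auto)
    have Fu: "F z = (z - a) * u z" for z using a by (simp add: u_def)
    have F0: "F 0 \<noteq> 0" using Suc.prems(3,4) by auto
    have u_sphere: "cmod (u z) \<le> 4/3 * M" if "cmod z = 1" for z
    proof -
      have "3/4 * cmod (u z) \<le> cmod (z - a) * cmod (u z)"
        using norm_triangle_ineq2[of z a] that a by (intro mult_right_mono) auto
      also have "\<dots> = cmod (F z)" by (simp add: Fu norm_mult)
      also have "\<dots> \<le> M" using Suc.prems(2)[of z] that by simp
      finally show ?thesis by simp
    qed
    have hu_cball: "u holomorphic_on cball 0 1" by (rule holomorphic_on_subset[OF hu]) auto
    have 2: "cmod (u z) \<le> 4/3 * M" if "z \<in> cball 0 1" for z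
      by (rule maximum_modulus_frontier[of u "cball 0 1"])
        (use that hu_cball u_sphere in \<open>auto intro: holomorphic_on_imp_continuous_on holomorphic_on_subset\<close>)
    have 3: "4 * m \<le> cmod (u 0)"
    proof -
      have "m \<le> cmod a * cmod (u 0)" using Suc.prems(3) by (simp add: Fu norm_mult)
      also have "\<dots> \<le> 1/4 * cmod (u 0)" using a by (intro mult_right_mono) auto
      finally show ?thesis by simp
    qed
    have m4: "0 < 4 * m" and M4: "4/3 * M < 3 ^ k * (4 * m)"
      using Suc.prems(4,5) by (simp_all add: mult_ac)
    obtain as where as: "length as \<le> k" and
      low: "\<And>z. cmod z < 1/8 \<Longrightarrow>
        (4 * m) ^ 3 / (2 * (4/3 * M))\<^sup>2 * (\<Prod>a\<leftarrow>as. cmod (z - a)) \<le> cmod (u z)"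
      using Suc.IH[OF hu 2 3 m4 M4] by blast
    have "m ^ 3 / (2 * M)\<^sup>2 * (\<Prod>a\<leftarrow>a # as. cmod (z - a)) \<le> cmod (F z)" if "cmod z < 1/8" for z
    proof -
      \<comment> \<open>Removing a zero multiplies m^3/M^2 by 4^3/(4/3)^2 = 36, so the original
        constant is the weaker one and survives the induction.\<close>
      have c: "m ^ 3 / (2 * M)\<^sup>2 \<le> (4 * m) ^ 3 / (2 * (4/3 * M))\<^sup>2"
        using Suc.prems(4) mM by (simp add: field_simps power2_eq_square power3_eq_cube)
      have "0 \<le> (\<Prod>a\<leftarrow>as. cmod (z - a))" by (induction as) auto
      then have "m ^ 3 / (2 * M)\<^sup>2 * (\<Prod>a\<leftarrow>as. cmod (z - a)) \<le> cmod (u z)"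
        using mult_right_mono[OF c] low[OF that] by (meson order_trans)
      then have "cmod (z - a) * (m ^ 3 / (2 * M)\<^sup>2 * (\<Prod>a\<leftarrow>as. cmod (z - a))) \<le> cmod (F z)"
        unfolding Fu norm_mult by (intro mult_left_mono) auto
      then show ?thesis by (simp add: mult_ac)
    qed
    then show ?thesis using as by (intro exI[of _ "a # as"]) auto
  qed
qed

section \<open>The chordal metric\<close>

text \<open>Stereographic projection to the unit sphere of C x R with infinity at the north pole. It
  turns \<open>sph_dist\<close> into Euclidean distance, from which the triangle inequality is
  inherited. The height (|a|^2 - 1)/(|a|^2 + 1) is written so that heights differ by a difference of
  the terms 2/(1 + |a|^2).\<close>

fun stereo :: "complex option \<Rightarrow> complex \<times> real" where
  "stereo (Some a) = (2 / of_real (1 + (cmod a)\<^sup>2) * a, 1 - 2 / (1 + (cmod a)\<^sup>2))"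
| "stereo None = (0, 1)"

lemma one_plus_sq_pos: "0 < 1 + (x::real)\<^sup>2"
  by (rule add_pos_nonneg) auto

lemma sph_dist_eq_dist_stereo: "sph_dist x y = dist (stereo x) (stereo y)"
proof -
  have sq: "(cmod (2 / of_real A * a - 2 / of_real B * b))\<^sup>2 + (2 / A - 2 / B)\<^sup>2
        = 4 * (cmod (a - b))\<^sup>2 / (A * B)"
    if "A = 1 + (cmod a)\<^sup>2" "B = 1 + (cmod b)\<^sup>2" for a b A B
  proof -
    have pos: "A > 0" "B > 0" using that one_plus_sq_pos by auto
    have sc: "2 / of_real A * a - 2 / of_real B * b = (2 / (A * B)) *\<^sub>R (B *\<^sub>R a - A *\<^sub>R b)"
      using pos by (simp add: scaleR_conv_of_real field_simps)
    have "(cmod (B *\<^sub>R a - A *\<^sub>R b))\<^sup>2 + (B - A)\<^sup>2 = (A * B) * (cmod (a - b))\<^sup>2"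
      unfolding that cmod_power2 by (simp add: power2_eq_square algebra_simps)
    moreover have "2 / A - 2 / B = (2 / (A * B)) * (B - A)" using pos by (simp add: field_simps)
    ultimately have "(cmod (2 / of_real A * a - 2 / of_real B * b))\<^sup>2 + (2 / A - 2 / B)\<^sup>2
        = (2 / (A * B))\<^sup>2 * ((A * B) * (cmod (a - b))\<^sup>2)"
      unfolding sc norm_scaleR by (simp only: power_mult_distrib power2_abs distrib_left[symmetric])
    also have "\<dots> = 4 * (cmod (a - b))\<^sup>2 / (A * B)"
      using pos by (simp add: field_simps power2_eq_square)
    finally show ?thesis .
  qed
  have inf: "sqrt ((cmod (2 / of_real A * a))\<^sup>2 + (2 / A)\<^sup>2) = 2 / sqrt A"
    if "A = 1 + (cmod a)\<^sup>2" for a A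
  proof -
    have pos: "A > 0" using that one_plus_sq_pos by auto
    have "cmod (2 / of_real A * a) = 2 / A * cmod a" using pos by (simp add: norm_mult norm_divide)
    then have "(cmod (2 / of_real A * a))\<^sup>2 + (2 / A)\<^sup>2 = (2 / A)\<^sup>2 * (1 + (cmod a)\<^sup>2)"
      by (simp only: power_mult_distrib distrib_left mult_1_right add.commute)
    then have "(cmod (2 / of_real A * a))\<^sup>2 + (2 / A)\<^sup>2 = (2 / A)\<^sup>2 * A"
      by (simp add: that)
    also have "\<dots> = 4 / A" using pos by (simp add: power2_eq_square)
    finally show ?thesis by (simp add: real_sqrt_divide)
  qed
  show ?thesis
  proof (cases x)
    case None
    then show ?thesis using inf by (cases y) (auto simp: dist_prod_def dist_norm dist_real_def)
  next
    case (Some a)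
    note x = this
    show ?thesis
    proof (cases y)
      case None
      then show ?thesis using x inf by (auto simp: dist_prod_def dist_norm dist_real_def)
    next
      case (Some b)
      have "dist (stereo x) (stereo y) = sqrt (4 * (cmod (a - b))\<^sup>2 / ((1 + (cmod a)\<^sup>2) * (1 + (cmod b)\<^sup>2)))"
        unfolding sq[OF refl refl, symmetric] x Some
        by (simp add: dist_prod_def dist_norm power2_commute)
      also have "\<dots> = 2 * cmod (a - b) / sqrt ((1 + (cmod a)\<^sup>2) * (1 + (cmod b)\<^sup>2))"
        by (simp add: real_sqrt_divide real_sqrt_mult)
      finally show ?thesis by (simp add: x Some)
    qed
  qed
qed

lemma sph_dist_triangle: "sph_dist x z \<le> sph_dist x y + sph_dist y z"
  and sph_dist_commute: "sph_dist x y = sph_dist y x"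
  and sph_dist_nonneg: "0 \<le> sph_dist x y"
  unfolding sph_dist_eq_dist_stereo by (auto intro: dist_triangle simp: dist_commute)

section \<open>Inversion as an isometry of the sphere, and comparison of chordal with Euclidean
  distance\<close>

fun sinv :: "complex option \<Rightarrow> complex option" where
  "sinv None = Some 0"
| "sinv (Some a) = (if a = 0 then None else Some (inverse a))"

lemma sinv_sinv [simp]: "sinv (sinv x) = x"
  by (cases x) auto

lemma sinv_eq_None_iff [simp]: "sinv x = None \<longleftrightarrow> x = Some 0"
  by (cases x) auto

lemma one_plus_sq_inverse:
  "r \<noteq> 0 \<Longrightarrow> 1 + (inverse r)\<^sup>2 = (1 + r\<^sup>2) / (r\<^sup>2 :: real)"
  by (simp add: field_simps)

lemma sph_dist_inverse:
  assumes "a \<noteq> 0" "b \<noteq> 0"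
  shows "sph_dist (Some (inverse a)) (Some (inverse b)) = sph_dist (Some a) (Some b)"
proof -
  have d: "cmod (inverse a - inverse b) = cmod (a - b) / (cmod a * cmod b)"
    unfolding inverse_diff_inverse[OF assms] norm_minus_cancel norm_mult norm_inverse
    by (simp add: field_simps)
  show ?thesis
    using assms unfolding sph_dist.simps d norm_inverse
    by (simp add: one_plus_sq_inverse real_sqrt_divide real_sqrt_mult)
qed

lemma sph_dist_inverse_None:
  "a \<noteq> 0 \<Longrightarrow> sph_dist (Some (inverse a)) None = sph_dist (Some a) (Some 0)"
  unfolding sph_dist.simps norm_inverse by (simp add: one_plus_sq_inverse real_sqrt_divide)

text \<open>Inversion is a half turn of the sphere. Through this lemma every estimate near infinity
  is obtained from one near 0.\<close>

lemma sph_dist_sinv [simp]: "sph_dist (sinv x) (sinv y) = sph_dist x y"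
proof -
  have inf: "sph_dist (sinv None) (sinv y) = sph_dist None y" for y
  proof (cases y)
    case (Some a)
    then show ?thesis
      using sph_dist_inverse_None[of "inverse a"] sph_dist_commute[of None "Some a"]
        sph_dist_commute[of "Some 0" "Some (inverse a)"] sph_dist_commute[of "Some 0" None]
      by (cases "a = 0") (simp_all del: sph_dist.simps)
  qed simp
  have zero: "sph_dist (sinv (Some 0)) (sinv y) = sph_dist (Some 0) y" for y
    using inf[of "sinv y"] by simp
  show ?thesis
  proof (cases "x \<in> {None, Some 0} \<or> y \<in> {None, Some 0}")
    case True
    then show ?thesis using inf zero sph_dist_commute by (metis empty_iff insert_iff)
  next
    case False
    then show ?thesis
      using sph_dist_inverse[of "the x" "the y"]
      by (cases x; cases y) (simp_all del: sph_dist.simps)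
  qed
qed

lemma sph_dist_Some_le: "sph_dist (Some a) (Some b) \<le> 2 * cmod (a - b)"
proof -
  have "1 \<le> (1 + (cmod a)\<^sup>2) * (1 + (cmod b)\<^sup>2)"
    using mult_mono[of 1 "1 + (cmod a)\<^sup>2" 1 "1 + (cmod b)\<^sup>2"] by simp
  then have "1 \<le> sqrt ((1 + (cmod a)\<^sup>2) * (1 + (cmod b)\<^sup>2))" by simp
  then have "2 * cmod (a - b) / sqrt ((1 + (cmod a)\<^sup>2) * (1 + (cmod b)\<^sup>2)) \<le> 2 * cmod (a - b) / 1"
    by (intro divide_left_mono) auto
  then show ?thesis by simp
qed

text \<open>Chordal distance 1/2 from infinity amounts to sqrt(1 + |a|^2) <= 4; this is the origin
  of the bound 4 used from here on.\<close>

lemma cmod_le_of_sph_dist_inf: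
  assumes "1/2 \<le> sph_dist x None"
  shows "x \<noteq> None \<and> cmod (the x) \<le> 4"
proof (cases x)
  case (Some a)
  then have "sqrt (1 + (cmod a)\<^sup>2) \<le> 4" using assms one_plus_sq_pos[of "cmod a"] by (simp add: field_simps)
  moreover have "cmod a \<le> sqrt (1 + (cmod a)\<^sup>2)" by (rule real_le_rsqrt) simp
  ultimately show ?thesis using Some by simp
qed (use assms in simp)

lemma sph_dist_zero_le: "sph_dist (Some a) (Some 0) \<le> 2 * cmod a"
  using sph_dist_Some_le[of a 0] by simp

text \<open>For values bounded by 4 the denominator of the chordal distance is at most 17, and 17/2
  is rounded up to 9. This turns spherical Cauchy sequences into Euclidean ones.\<close>

lemma sph_dist_finite_lower:
  assumes "cmod a \<le> 4" "cmod b \<le> 4"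
  shows "cmod (a - b) \<le> 9 * sph_dist (Some a) (Some b)"
proof -
  have le: "1 + (cmod c)\<^sup>2 \<le> 17" if "cmod c \<le> 4" for c :: complex
    using power_mono[OF that, of 2] by simp
  have "(1 + (cmod a)\<^sup>2) * (1 + (cmod b)\<^sup>2) \<le> 17 * 17"
    using le assms by (intro mult_mono) auto
  then have "sqrt ((1 + (cmod a)\<^sup>2) * (1 + (cmod b)\<^sup>2)) \<le> 17" by (intro real_le_lsqrt) auto
  moreover have "0 < sqrt ((1 + (cmod a)\<^sup>2) * (1 + (cmod b)\<^sup>2))" using one_plus_sq_pos by simp
  ultimately have "2 * cmod (a - b) / 17 \<le> sph_dist (Some a) (Some b)"
    unfolding sph_dist.simps by (intro divide_left_mono) auto
  then show ?thesis using norm_ge_zero[of "a - b"] by linarith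
qed

text \<open>No condition is imposed at the poles; those are covered by requiring \<open>sph_holo\<close> of \<open>1/f\<close> as well.\<close>
definition sph_holo :: "(complex \<Rightarrow> complex option) \<Rightarrow> bool" where
  "sph_holo f \<longleftrightarrow> open {z. f z \<noteq> None} \<and> (\<lambda>z. the (f z)) holomorphic_on {z. f z \<noteq> None}"

lemma sph_holo_isCont:
  assumes "sph_holo f" "f p \<noteq> None"
  shows "isCont (\<lambda>z. the (f z)) p"
  using assms holomorphic_on_imp_continuous_on continuous_on_eq_continuous_at
  unfolding sph_holo_def by fastforce

lemma meromorphic_imp_sph_holo:
  assumes "meromorphic_C f"
  shows "sph_holo f"
proof -
  have "\<exists>e>0. ball p e \<subseteq> {z. f z \<noteq> None}" if p: "f p \<noteq> None" for p
  proof -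
    obtain e where "e > 0" "\<forall>w\<in>ball p e - {p}. f w \<noteq> None"
      using assms unfolding meromorphic_C_def by meson
    then show ?thesis using p by (intro exI[of _ e]) auto
  qed
  then show ?thesis
    using assms unfolding meromorphic_C_def sph_holo_def open_contains_ball by simp
qed

text \<open>At a pole 1/f tends to 0, which is the value that \<open>sinv\<close> assigns there.
  Thus 1/f is continuous at the pole and the singularity is removable.\<close>

lemma meromorphic_imp_sph_holo_sinv:
  assumes "meromorphic_C f"
  shows "sph_holo (\<lambda>z. sinv (f z))"
proof -
  define g where "g = (\<lambda>z. the (sinv (f z)))"
  have loc: "\<exists>e>0. ball p e \<subseteq> {z. f z \<noteq> Some 0} \<and> g holomorphic_on ball p e" if p: "f p \<noteq> Some 0" for p
  proof -
    have hf: "sph_holo f" by (rule meromorphic_imp_sph_holo[OF assms])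
    obtain e0 where e0: "e0 > 0" and "\<forall>w\<in>ball p e0 - {p}. f w \<noteq> None"
      using assms unfolding meromorphic_C_def by meson
    then have nN: "\<And>w. w \<in> ball p e0 \<Longrightarrow> w \<noteq> p \<Longrightarrow> f w \<noteq> None" by auto
    have "\<forall>\<^sub>F z in at p. f z \<noteq> Some 0"
    proof (cases "f p")
      case None
      then have "filterlim (\<lambda>z. the (f z)) at_infinity (at p)"
        using assms unfolding meromorphic_C_def by blast
      then have "\<forall>\<^sub>F z in at p. the (f z) \<noteq> 0"
        using filterlim_at_infinity_imp_eventually_ne by blast
      then show ?thesis by eventually_elim auto
    next
      case (Some a)
      then have "isCont (\<lambda>z. the (f z)) p" using sph_holo_isCont[OF hf] by simp
      then have "((\<lambda>z. the (f z)) \<longlongrightarrow> a) (at p)" using Some by (simp add: isCont_def)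
      then have "\<forall>\<^sub>F z in at p. the (f z) \<noteq> 0"
        using p Some by (intro tendsto_imp_eventually_ne) auto
      then show ?thesis by eventually_elim auto
    qed
    then obtain e1 where e1: "e1 > 0" "\<And>z. z \<in> ball p e1 \<Longrightarrow> z \<noteq> p \<Longrightarrow> f z \<noteq> Some 0"
      unfolding eventually_at by (metis UNIV_I dist_commute mem_ball)
    define e where "e = min e0 e1"
    have e: "e > 0" "\<And>w. w \<in> ball p e \<Longrightarrow> w \<noteq> p \<Longrightarrow> f w \<noteq> None"
      "\<And>w. w \<in> ball p e \<Longrightarrow> f w \<noteq> Some 0"
      using e0 e1 nN p by (auto simp: e_def)
    have ginv: "g w = inverse (the (f w))" if "f w \<noteq> None" "f w \<noteq> Some 0" for w
      using that by (auto simp: g_def)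
    have hol: "g holomorphic_on ball p e \<inter> {z. f z \<noteq> None}"
    proof -
      have "(\<lambda>w. inverse (the (f w))) holomorphic_on ball p e \<inter> {z. f z \<noteq> None}"
        using hf e(3) unfolding sph_holo_def
        by (intro holomorphic_intros) (auto intro: holomorphic_on_subset)
      then show ?thesis
        by (rule holomorphic_transform) (use ginv e(3) in auto)
    qed
    have "g holomorphic_on ball p e"
    proof (cases "f p")
      case (Some a)
      then have "ball p e \<inter> {z. f z \<noteq> None} = ball p e" using e(2) by fastforce
      then show ?thesis using hol by simp
    next
      case None
      have eq: "ball p e \<inter> {z. f z \<noteq> None} = ball p e - {p}" using e(2) None by auto
      have "filterlim (\<lambda>z. the (f z)) at_infinity (at p)"
        using assms None unfolding meromorphic_C_def by blast
      then have "((\<lambda>w. inverse (the (f w))) \<longlongrightarrow> 0) (at p)"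
        using filterlim_compose tendsto_inverse_0 by blast
      moreover have "\<forall>\<^sub>F w in at p. inverse (the (f w)) = g w"
        unfolding eventually_at using ginv e
        by (intro exI[of _ e]) (auto simp: dist_commute)
      ultimately have "(g \<longlongrightarrow> g p) (at p)"
        using None by (auto simp: g_def intro: Lim_transform_eventually)
      then have cp: "isCont g p" by (simp add: isCont_def)
      have "continuous_on (ball p e) g"
        unfolding continuous_on_eq_continuous_at[OF open_ball]
      proof
        fix w assume w: "w \<in> ball p e"
        have "continuous_on (ball p e - {p}) g"
          using hol eq holomorphic_on_imp_continuous_on by metis
        then show "isCont g w"
          using w cp by (cases "w = p") (auto simp: continuous_on_eq_continuous_at open_delete)
      qed
      then show ?thesis
        by (rule no_isolated_singularity[where K = "{p}"]) (use hol eq in simp_all)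
    qed
    then show ?thesis using e by blast
  qed
  have set: "{z. sinv (f z) \<noteq> None} = {z. f z \<noteq> Some 0}" by simp
  have op: "open {z. f z \<noteq> Some 0}" unfolding open_contains_ball using loc by blast
  have "g holomorphic_on {z. f z \<noteq> Some 0}"
    unfolding holomorphic_on_open[OF op]
  proof
    fix p assume "p \<in> {z. f z \<noteq> Some 0}"
    then obtain e where "e > 0" "g holomorphic_on ball p e" using loc by blast
    then show "\<exists>f'. DERIV g p :> f'" unfolding holomorphic_on_open[OF open_ball] by simp
  qed
  then show ?thesis using op unfolding sph_holo_def set g_def by simp
qed

lemma sph_holo_continuous_finite:
  assumes "sph_holo f" "f p \<noteq> None" "e > 0"
  shows "\<forall>\<^sub>F z in nhds p. sph_dist (f z) (f p) < e"
proof -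
  have "isCont (\<lambda>z. the (f z)) p" by (rule sph_holo_isCont[OF assms(1,2)])
  then have "((\<lambda>z. the (f z)) \<longlongrightarrow> the (f p)) (nhds p)"
    unfolding isCont_def by (simp add: tendsto_nhds_iff)
  then have "\<forall>\<^sub>F z in nhds p. dist (the (f z)) (the (f p)) < e / 2"
    using assms(3) by (intro tendstoD) auto
  moreover have "\<forall>\<^sub>F z in nhds p. z \<in> {z. f z \<noteq> None}"
    using assms(1,2) unfolding sph_holo_def by (intro eventually_nhds_in_open) auto
  ultimately show ?thesis
  proof eventually_elim
    case (elim z)
    then show ?case
      using sph_dist_Some_le[of "the (f z)" "the (f p)"] assms(2) by (auto simp: dist_norm)
  qed
qed

text \<open>A weakening of \<open>N1\<close> that is visibly invariant under replacing \<open>f\<close> by \<open>1/f\<close>.\<close>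
definition N1_sym :: "(complex \<Rightarrow> complex option) \<Rightarrow> bool" where
  "N1_sym f \<longleftrightarrow> sph_holo f \<and> sph_holo (\<lambda>z. sinv (f z)) \<and>
     (\<forall>h::nat \<Rightarrow> complex. \<exists>s. strict_mono s \<and> loc_unif_cauchy_sph (\<lambda>n z. f (z + h (s n)))) \<and>
     \<not> (\<exists>(h::nat \<Rightarrow> complex) (c::complex option). loc_unif_conv_sph (\<lambda>n z. f (z + h n)) (\<lambda>_. c))"

lemma N1_imp_N1_sym: "N1 f \<Longrightarrow> N1_sym f"
  unfolding N1_def N1_sym_def normal_mero_def
  using meromorphic_imp_sph_holo meromorphic_imp_sph_holo_sinv by blast

lemma N1_sym_sinv:
  assumes "N1_sym f"
  shows "N1_sym (\<lambda>z. sinv (f z))"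
proof -
  have "\<not> loc_unif_conv_sph (\<lambda>n z. sinv (f (z + h n))) (\<lambda>_. c)" for h :: "nat \<Rightarrow> complex" and c
  proof
    assume "loc_unif_conv_sph (\<lambda>n z. sinv (f (z + h n))) (\<lambda>_. c)"
    then have "loc_unif_conv_sph (\<lambda>n z. f (z + h n)) (\<lambda>_. sinv c)"
      unfolding loc_unif_conv_sph_def by (metis sph_dist_sinv sinv_sinv)
    then show False using assms unfolding N1_sym_def by blast
  qed
  then show ?thesis using assms unfolding N1_sym_def by (simp add: loc_unif_cauchy_sph_def)
qed

lemma N1_sym_continuous:
  assumes "N1_sym f" "e > 0"
  shows "\<forall>\<^sub>F z in nhds p. sph_dist (f z) (f p) < e"
proof (cases "f p = None")
  case True
  have "sph_holo (\<lambda>z. sinv (f z))" using assms unfolding N1_sym_def by blast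
  from sph_holo_continuous_finite[OF this, of p e] True show ?thesis
    using assms(2) unfolding sph_dist_sinv by simp
next
  case False
  then show ?thesis using assms sph_holo_continuous_finite unfolding N1_sym_def by blast
qed

section \<open>Uniform local estimates\<close>

text \<open>If this failed along points \<open>p n\<close>, a subsequence of the translates by
  \<open>p n\<close> would be uniformly Cauchy on the unit disc. Late translates could then be
  compared with one fixed translate, whose continuity at 0 gives the contradiction by a
  three-epsilon estimate.\<close>

lemma N1_sym_equicontinuous:
  assumes f: "N1_sym f" and e: "e > 0"
  shows "\<exists>d>0. \<forall>p z. dist z p < d \<longrightarrow> sph_dist (f z) (f p) < e"
proof (rule ccontr)
  assume "\<not> ?thesis"
  then have "\<forall>n. \<exists>p z. dist z p < 1 / real (Suc n) \<and> e \<le> sph_dist (f z) (f p)"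
    by (metis not_less of_nat_0_less_iff zero_less_Suc zero_less_divide_1_iff)
  then obtain p z where pz: "\<And>n. dist (z n) (p n) < 1 / real (Suc n)"
    "\<And>n. e \<le> sph_dist (f (z n)) (f (p n))" by metis
  obtain s where s: "strict_mono s" "loc_unif_cauchy_sph (\<lambda>n x. f (x + p (s n)))"
    using f unfolding N1_sym_def by blast
  then obtain N where N: "\<And>m n x. m \<ge> N \<Longrightarrow> n \<ge> N \<Longrightarrow> x \<in> cball 0 1 \<Longrightarrow>
      sph_dist (f (x + p (s m))) (f (x + p (s n))) < e / 3"
    unfolding loc_unif_cauchy_sph_def using e by (meson compact_cball divide_pos_pos zero_less_numeral)
  have "\<forall>\<^sub>F x in nhds (p (s N)). sph_dist (f x) (f (p (s N))) < e / 3"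
    using e by (intro N1_sym_continuous[OF f]) auto
  then obtain d where d: "d > 0" "\<And>x. dist x (p (s N)) < d \<Longrightarrow> sph_dist (f x) (f (p (s N))) < e / 3"
    unfolding eventually_nhds_metric by blast
  \<comment> \<open>\<open>d\<close> serves continuity at \<open>p (s N)\<close>; the bound 1 keeps
    the offset \<open>x\<close> in the disc where the Cauchy estimate holds.\<close>
  obtain n0 where n0: "1 / real (Suc n0) < min d 1"
    using d(1) reals_Archimedean[of "min d 1"] by (auto simp: inverse_eq_divide)
  define n where "n = max N n0"
  have "n0 \<le> s n" using seq_suble[OF s(1), of n] by (simp add: n_def)
  then have "1 / real (Suc (s n)) \<le> 1 / real (Suc n0)" by (intro divide_left_mono) auto
  then have dn: "dist (z (s n)) (p (s n)) < min d 1" using pz(1)[of "s n"] n0 by linarith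
  define x where "x = z (s n) - p (s n)"
  have x: "norm x < d" "x \<in> cball 0 1" using dn by (auto simp: x_def dist_norm norm_minus_commute)
  have zx: "z (s n) = x + p (s n)" by (simp add: x_def)
  have "e \<le> sph_dist (f (x + p (s n))) (f (0 + p (s n)))" using pz(2)[of "s n"] zx by simp
  also have "\<dots> \<le> sph_dist (f (x + p (s n))) (f (x + p (s N))) +
      (sph_dist (f (x + p (s N))) (f (0 + p (s N))) + sph_dist (f (0 + p (s N))) (f (0 + p (s n))))"
    using sph_dist_triangle by (meson add_left_mono order_trans)
  also have "\<dots> < e / 3 + (e / 3 + e / 3)"
    using N[of n N x] N[of N n 0] d(2)[of "x + p (s N)"] x
    by (intro add_strict_mono) (auto simp: n_def dist_norm)
  finally show False by simp
qed

section \<open>Discs on which f stays close to 0 or infinity\<close>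

lemma sph_dist_zero_inf_le: "2 \<le> sph_dist x (Some 0) + sph_dist x None"
  using sph_dist_triangle[of "Some 0" None x] by (simp add: sph_dist_commute)

text \<open>Identity theorem: the interior of the set on which the translates tend to 0 is also closed.\<close>
lemma N1_sym_tendsto_zero_contradiction:
  assumes f: "N1_sym f" and cau: "loc_unif_cauchy_sph (\<lambda>n z. f (z + h n))" and r: "r > 0"
    and lim: "\<And>z. z \<in> ball 0 r \<Longrightarrow> (\<lambda>n. sph_dist (f (z + h n)) (Some 0)) \<longlonglongrightarrow> 0"
  shows False
proof -
  define A where "A = {z. (\<lambda>n. sph_dist (f (z + h n)) (Some 0)) \<longlonglongrightarrow> 0}"
  have A_iff: "z \<in> A \<longleftrightarrow> (\<forall>e>0. \<forall>\<^sub>F n in sequentially. sph_dist (f (z + h n)) (Some 0) < e)" for z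
    by (simp add: A_def tendsto_iff sph_dist_nonneg)
  have "closed A"
    unfolding closed_limpt islimpt_approachable
  proof (intro allI impI)
    fix z assume z: "\<forall>e>0. \<exists>x'\<in>A. x' \<noteq> z \<and> dist x' z < e"
    show "z \<in> A" unfolding A_iff
    proof (intro allI impI)
      fix e :: real assume e: "e > 0"
      then obtain d where d: "d > 0" "\<And>p z. dist z p < d \<Longrightarrow> sph_dist (f z) (f p) < e / 2"
        using N1_sym_equicontinuous[OF f, of "e / 2"] by auto
      obtain w where w: "w \<in> A" "dist w z < d" using z d(1) by blast
      have "\<forall>\<^sub>F n in sequentially. sph_dist (f (w + h n)) (Some 0) < e / 2"
        using w(1) e unfolding A_iff by (meson half_gt_zero)
      then show "\<forall>\<^sub>F n in sequentially. sph_dist (f (z + h n)) (Some 0) < e"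
      proof eventually_elim
        case (elim n)
        have "sph_dist (f (z + h n)) (f (w + h n)) < e / 2"
          by (rule d(2)) (use w(2) in \<open>simp add: dist_commute\<close>)
        then show ?case using elim sph_dist_triangle[of "f (z + h n)" "Some 0" "f (w + h n)"] by linarith
      qed
    qed
  qed
  \<comment> \<open>Within \<open>\<delta>\<close> of a point where a translate is 1/4-close to 0,
    it stays 1/2-close to 0, hence far from infinity and bounded by 4. The radius is the same for
    all translates.\<close>
  obtain \<delta> where \<delta>: "\<delta> > 0" "\<And>p z. dist z p < \<delta> \<Longrightarrow> sph_dist (f z) (f p) < 1/4"
    using N1_sym_equicontinuous[OF f, of "1/4"] by auto
  have hf: "sph_holo f" using f unfolding N1_sym_def by blast
  \<comment> \<open>Around a point of \<open>A\<close> the translates converge to a holomorphic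
    \<open>g\<close> whose zeros are exactly the points of \<open>A\<close>; vanishing on an open
    piece of the ball, \<open>g\<close> vanishes on all of it.\<close>
  have spread: "ball z \<delta> \<subseteq> A" if z: "z \<in> A" and V: "x \<in> interior A \<inter> ball z \<delta>" for z x
  proof -
    have "\<forall>\<^sub>F n in sequentially. sph_dist (f (z + h n)) (Some 0) < 1/4"
      using z unfolding A_iff by (meson zero_less_divide_1_iff zero_less_numeral)
    then obtain N0 where N0: "\<And>n. n \<ge> N0 \<Longrightarrow> sph_dist (f (z + h n)) (Some 0) < 1/4"
      unfolding eventually_sequentially by blast
    define G where "G = (\<lambda>n w. the (f (w + h (n + N0))))"
    have fin: "f (w + h (n + N0)) = Some (G n w) \<and> cmod (G n w) \<le> 4" if w: "w \<in> ball z \<delta>" for n w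
    proof -
      have "sph_dist (f (w + h (n + N0))) (f (z + h (n + N0))) < 1/4"
        by (rule \<delta>(2)) (use w in \<open>simp add: dist_commute\<close>)
      then have "1/2 \<le> sph_dist (f (w + h (n + N0))) None"
        using N0[of "n + N0"] sph_dist_triangle[of "f (w + h (n + N0))" "Some 0" "f (z + h (n + N0))"]
          sph_dist_zero_inf_le[of "f (w + h (n + N0))"] by linarith
      then show ?thesis using cmod_le_of_sph_dist_inf unfolding G_def by auto
    qed
    have holG: "G n holomorphic_on ball z \<delta>" for n
    proof -
      have "((\<lambda>w. the (f w)) \<circ> (\<lambda>w. w + h (n + N0))) holomorphic_on ball z \<delta>"
        using hf fin unfolding sph_holo_def
        by (intro holomorphic_on_compose_gen[where t = "{z. f z \<noteq> None}"] holomorphic_intros) fastforce+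
      then show ?thesis by (simp add: G_def o_def)
    qed
    define g where "g = (\<lambda>w. lim (\<lambda>n. G n w))"
    have ul: "uniform_limit K G g sequentially" if K: "compact K" "K \<subseteq> ball z \<delta>" for K
    proof -
      have "uniformly_Cauchy_on K G" unfolding uniformly_Cauchy_on_def
      proof (intro allI impI)
        fix e :: real assume e: "e > 0"
        then obtain N where N: "\<And>m n w. m \<ge> N \<Longrightarrow> n \<ge> N \<Longrightarrow> w \<in> K \<Longrightarrow>
            sph_dist (f (w + h m)) (f (w + h n)) < e / 9"
          using cau K(1) unfolding loc_unif_cauchy_sph_def by (meson divide_pos_pos zero_less_numeral)
        have "dist (G m w) (G n w) < e" if "m \<ge> N" "n \<ge> N" "w \<in> K" for m n w
        proof -
          have "w \<in> ball z \<delta>" using that K by auto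
          then have "cmod (G m w - G n w) \<le> 9 * sph_dist (f (w + h (m + N0))) (f (w + h (n + N0)))"
            using fin[of w] sph_dist_finite_lower[of "G m w" "G n w"] by (simp del: sph_dist.simps)
          then show ?thesis using N[of "m + N0" "n + N0" w] that by (simp add: dist_norm)
        qed
        then show "\<exists>M. \<forall>w\<in>K. \<forall>m\<ge>M. \<forall>n\<ge>M. dist (G m w) (G n w) < e" by blast
      qed
      then show ?thesis
        unfolding g_def using Cauchy_uniformly_convergent uniformly_convergent_uniform_limit_iff by blast
    qed
    have holg: "g holomorphic_on ball z \<delta>"
    proof (rule holomorphic_uniform_sequence[OF open_ball holG])
      fix x assume "x \<in> ball z \<delta>"
      then obtain d where "d > 0" "cball x d \<subseteq> ball z \<delta>"
        using open_contains_cball_eq[OF open_ball] by blast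
      then show "\<exists>d>0. cball x d \<subseteq> ball z \<delta> \<and> uniform_limit (cball x d) G g sequentially"
        using ul by auto
    qed
    have g0: "w \<in> A \<longleftrightarrow> g w = 0" if w: "w \<in> ball z \<delta>" for w
    proof -
      have Gg: "(\<lambda>n. G n w) \<longlonglongrightarrow> g w"
        using ul[of "{w}"] w by (auto intro: tendsto_uniform_limitI)
      have up: "sph_dist (f (w + h (n + N0))) (Some 0) \<le> 2 * cmod (G n w)" for n
        using fin[OF w, of n] sph_dist_zero_le[of "G n w"] by (simp del: sph_dist.simps)
      have lo: "cmod (G n w) \<le> 9 * sph_dist (f (w + h (n + N0))) (Some 0)" for n
        using fin[OF w, of n] sph_dist_finite_lower[of "G n w" 0] by (simp del: sph_dist.simps)
      have "w \<in> A \<longleftrightarrow> (\<lambda>n. sph_dist (f (w + h (n + N0))) (Some 0)) \<longlonglongrightarrow> 0"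
        unfolding A_def mem_Collect_eq
        by (rule iffI, erule LIMSEQ_ignore_initial_segment, erule LIMSEQ_offset)
      also have "\<dots> \<longleftrightarrow> (\<lambda>n. G n w) \<longlonglongrightarrow> 0"
      proof
        assume "(\<lambda>n. sph_dist (f (w + h (n + N0))) (Some 0)) \<longlonglongrightarrow> 0"
        then show "(\<lambda>n. G n w) \<longlonglongrightarrow> 0"
          by (rule Lim_null_comparison[rotated, OF tendsto_mult_right_zero[of _ _ 9]])
            (use lo in simp)
      next
        assume "(\<lambda>n. G n w) \<longlonglongrightarrow> 0"
        then have "(\<lambda>n. 2 * cmod (G n w)) \<longlonglongrightarrow> 0"
          by (intro tendsto_mult_right_zero tendsto_norm_zero)
        then show "(\<lambda>n. sph_dist (f (w + h (n + N0))) (Some 0)) \<longlonglongrightarrow> 0"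
          by (rule Lim_null_comparison[rotated]) (use up sph_dist_nonneg in simp)
      qed
      also have "\<dots> \<longleftrightarrow> g w = 0"
        using Gg LIMSEQ_unique[OF Gg, of 0] by (intro iffI) simp_all
      finally show ?thesis .
    qed
    have "x islimpt (interior A \<inter> ball z \<delta>)"
      using V by (intro interior_limit_point) (simp add: interior_open)
    then have "g w = 0" if "w \<in> ball z \<delta>" for w
      using analytic_continuation[OF holg open_ball connected_ball, of "interior A \<inter> ball z \<delta>" x w]
        V that g0 interior_subset[of A] by blast
    then show ?thesis using g0 by blast
  qed
  have "closed (interior A)"
    unfolding closed_limpt
  proof (intro allI impI)
    fix z assume z: "z islimpt interior A"
    then have "z islimpt A" using interior_subset islimpt_subset by blast
    then have zA: "z \<in> A" using \<open>closed A\<close> closed_limpt by blast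
    obtain x where "x \<in> interior A \<inter> ball z \<delta>"
      using z \<delta>(1) unfolding islimpt_approachable by (auto simp: dist_commute)
    from spread[OF zA this] show "z \<in> interior A"
      using \<delta>(1) by (meson centre_in_ball interiorI open_ball)
  qed
  moreover have "0 \<in> interior A"
    using lim r by (intro interiorI[of "ball 0 r"]) (auto simp: A_def)
  ultimately have "interior A = UNIV" using clopen[of "interior A"] by auto
  then have all: "z \<in> A" for z using interior_subset by blast
  have "loc_unif_conv_sph (\<lambda>n z. f (z + h n)) (\<lambda>_. Some 0)"
    unfolding loc_unif_conv_sph_def
  proof (intro allI impI)
    fix K :: "complex set" and e :: real assume "compact K" "e > 0"
    then obtain N where N: "\<And>m n w. m \<ge> N \<Longrightarrow> n \<ge> N \<Longrightarrow> w \<in> K \<Longrightarrow>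
        sph_dist (f (w + h m)) (f (w + h n)) < e / 2"
      using cau unfolding loc_unif_cauchy_sph_def by (meson half_gt_zero)
    \<comment> \<open>The Cauchy estimate makes \<open>N\<close> independent of \<open>w\<close>;
      the pointwise limit is used only at one later index, which may depend on
      \<open>w\<close>.\<close>
    have "sph_dist (f (w + h n)) (Some 0) < e" if "n \<ge> N" "w \<in> K" for n w
    proof -
      have "\<forall>\<^sub>F n in sequentially. sph_dist (f (w + h n)) (Some 0) < e / 2"
        using all[of w] \<open>e > 0\<close> unfolding A_iff by (meson half_gt_zero)
      then obtain M where M: "\<And>m. m \<ge> M \<Longrightarrow> sph_dist (f (w + h m)) (Some 0) < e / 2"
        unfolding eventually_sequentially by blast
      show ?thesis
        using N[of n "max N M" w] M[of "max N M"] that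
          sph_dist_triangle[of "f (w + h n)" "Some 0" "f (w + h (max N M))"] by simp
    qed
    then show "\<exists>N. \<forall>n\<ge>N. \<forall>z\<in>K. sph_dist (f (z + h n)) (Some 0) < e" by blast
  qed
  then show False using f unfolding N1_sym_def by blast
qed

text \<open>The alternative in \<open>near\<close> is decided by continuity: the centre is within 1
  of 0 and the oscillation is below 1/2, so the distance to infinity exceeds 2 - 3/2 = 1/2. The
  values are therefore the ones near 0, and the translates tend to 0 on a disc.\<close>

lemma N1_sym_almost_zero_contradiction:
  assumes f: "N1_sym f" and cau: "loc_unif_cauchy_sph (\<lambda>n z. f (z + h n))" and d: "d > 0"
    and near: "\<And>n z. z \<in> ball 0 d \<Longrightarrow>
      sph_dist (f (z + h n)) (Some 0) < 1 / real (Suc n) \<or> sph_dist (f (z + h n)) None < 1 / real (Suc n)"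
    and N: "\<And>n. n \<ge> N \<Longrightarrow> sph_dist (f (h n)) (Some 0) < 1"
  shows False
proof -
  obtain \<delta> where \<delta>: "\<delta> > 0" "\<And>p z. dist z p < \<delta> \<Longrightarrow> sph_dist (f z) (f p) < 1/2"
    using N1_sym_equicontinuous[OF f, of "1/2"] by auto
  show False
  proof (rule N1_sym_tendsto_zero_contradiction[OF f cau, of "min d \<delta>"])
    fix z :: complex assume z: "z \<in> ball 0 (min d \<delta>)"
    have "sph_dist (f (z + h n)) (Some 0) < 1 / real (Suc n)" if n: "n \<ge> max N 2" for n
    proof -
      have "sph_dist (f (z + h n)) (f (h n)) < 1/2" by (rule \<delta>(2)) (use z in \<open>simp add: dist_norm\<close>)
      then have "sph_dist (f (z + h n)) (Some 0) < 3/2"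
        using N[of n] n sph_dist_triangle[of "f (z + h n)" "Some 0" "f (h n)"] by simp
      then have "1/2 < sph_dist (f (z + h n)) None" using sph_dist_zero_inf_le[of "f (z + h n)"] by linarith
      moreover have "1 / real (Suc n) \<le> 1/2" using n by (simp add: field_simps)
      moreover have "z \<in> ball 0 d" using z by simp
      ultimately show ?thesis using near[of z n] by linarith
    qed
    then have ev: "\<forall>\<^sub>F n in sequentially. norm (sph_dist (f (z + h n)) (Some 0)) \<le> 1 / real (Suc n)"
      unfolding eventually_sequentially using sph_dist_nonneg by (metis abs_of_nonneg less_imp_le real_norm_def)
    show "(\<lambda>n. sph_dist (f (z + h n)) (Some 0)) \<longlonglongrightarrow> 0"
      by (rule Lim_null_comparison[OF ev]) (use LIMSEQ_inverse_real_of_nat in \<open>simp add: inverse_eq_divide\<close>)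
  qed (use d \<delta> in auto)
qed

text \<open>Otherwise there are discs of radius \<open>d\<close> on which f clings to {0, infinity}
  ever more closely. Along a Cauchy subsequence the values at the centres settle near one of the two
  points, and inversion reduces infinity to 0.\<close>

lemma N1_sym_uniformly_nonconstant:
  assumes f: "N1_sym f" and d: "d > 0"
  shows "\<exists>\<eta>>0. \<forall>p. \<exists>q\<in>ball p d. \<eta> \<le> sph_dist (f q) (Some 0) \<and> \<eta> \<le> sph_dist (f q) None"
proof (rule ccontr)
  assume "\<not> ?thesis"
  then have "\<forall>n. \<exists>p. \<forall>q\<in>ball p d.
      sph_dist (f q) (Some 0) < 1 / real (Suc n) \<or> sph_dist (f q) None < 1 / real (Suc n)"
    by (metis not_less of_nat_0_less_iff zero_less_Suc zero_less_divide_1_iff)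
  then obtain p where p: "\<And>n q. q \<in> ball (p n) d \<Longrightarrow>
      sph_dist (f q) (Some 0) < 1 / real (Suc n) \<or> sph_dist (f q) None < 1 / real (Suc n)" by metis
  obtain s where s: "strict_mono s" "loc_unif_cauchy_sph (\<lambda>n x. f (x + p (s n)))"
    using f unfolding N1_sym_def by blast
  have near: "sph_dist (f (z + p (s n))) (Some 0) < 1 / real (Suc n) \<or>
      sph_dist (f (z + p (s n))) None < 1 / real (Suc n)" if "z \<in> ball 0 d" for n z
  proof -
    have "1 / real (Suc (s n)) \<le> 1 / real (Suc n)"
      using seq_suble[OF s(1), of n] by (intro divide_left_mono) auto
    moreover have "z + p (s n) \<in> ball (p (s n)) d" using that by (simp add: dist_norm)
    ultimately show ?thesis using p[of "z + p (s n)" "s n"] by fastforce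
  qed
  obtain M where M: "\<And>m n x. m \<ge> M \<Longrightarrow> n \<ge> M \<Longrightarrow> x \<in> {0} \<Longrightarrow>
      sph_dist (f (x + p (s m))) (f (x + p (s n))) < 1/2"
    using s(2) unfolding loc_unif_cauchy_sph_def by (meson compact_sing half_gt_zero_iff zero_less_one)
  \<comment> \<open>The 1 ensures 1/(N + 1) <= 1/2, so that the centre value at index
    \<open>N\<close> plus the Cauchy error 1/2 stays below 1.\<close>
  define N where "N = max M 1"
  have N: "sph_dist (f (p (s n))) (f (p (s N))) < 1/2" if "n \<ge> N" for n
    using M[of n N 0] that by (simp add: N_def)
  have "1 / real (Suc N) \<le> 1/2" by (simp add: N_def field_simps)
  then consider "sph_dist (f (p (s N))) (Some 0) < 1/2" | "sph_dist (f (p (s N))) None < 1/2"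
    using near[of 0 N] d unfolding add_0 centre_in_ball by linarith
  then show False
  proof cases
    case 1
    then have "sph_dist (f (p (s n))) (Some 0) < 1" if "n \<ge> N" for n
      using N[OF that] sph_dist_triangle[of "f (p (s n))" "Some 0" "f (p (s N))"] by linarith
    then show False using N1_sym_almost_zero_contradiction[OF f s(2) d near] by blast
  next
    case 2
    have zero: "sph_dist (sinv x) (Some 0) = sph_dist x None" and
      inf: "sph_dist (sinv x) None = sph_dist x (Some 0)" for x
      using sph_dist_sinv[of x None] sph_dist_sinv[of x "Some 0"] by simp_all
    have "sph_dist (f (p (s n))) None < 1" if "n \<ge> N" for n
      using 2 N[OF that] sph_dist_triangle[of "f (p (s n))" None "f (p (s N))"] by linarith
    moreover have "loc_unif_cauchy_sph (\<lambda>n x. sinv (f (x + p (s n))))"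
      using s(2) unfolding loc_unif_cauchy_sph_def sph_dist_sinv .
    ultimately show False
      using N1_sym_almost_zero_contradiction[OF N1_sym_sinv[OF f], of "\<lambda>n. p (s n)" d N] near d
      unfolding zero inf by blast
  qed
qed

section \<open>The logarithmic bound on discs of fixed radius\<close>

lemma abs_log_abs_sinv [simp]: "abs_log_abs (sinv x) = abs_log_abs x"
  by (cases x) (auto simp: norm_inverse ln_inverse)

text \<open>Each factor is at least min(1, |z - \<tau> a|). The map \<open>\<tau>\<close> lets the
  zeros be located in a rescaled coordinate while the logarithms are taken in the original one.
  Points z = \<tau> a are excluded because \<open>ln 0\<close> is a mere default value.\<close>

lemma exp_neg_sum_le_prod:
  fixes w z :: complex
  assumes "\<And>a. a \<in> set as \<Longrightarrow> z \<noteq> \<tau> a \<and> cmod (z - \<tau> a) \<le> cmod (w - a)"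
  shows "exp (- (\<Sum>a\<leftarrow>as. max 0 (- ln (cmod (z - \<tau> a))))) \<le> (\<Prod>a\<leftarrow>as. cmod (w - a))"
  using assms
proof (induction as)
  case (Cons a as)
  have "exp (- max 0 (- ln (cmod (z - \<tau> a)))) \<le> exp (ln (cmod (z - \<tau> a)))" by simp
  also have "\<dots> \<le> cmod (w - a)" using Cons.prems[of a] by simp
  finally have "exp (- max 0 (- ln (cmod (z - \<tau> a)))) * exp (- (\<Sum>a\<leftarrow>as. max 0 (- ln (cmod (z - \<tau> a)))))
      \<le> cmod (w - a) * (\<Prod>a\<leftarrow>as. cmod (w - a))"
    using Cons by (intro mult_mono) auto
  then show ?case by (simp add: exp_add[symmetric])
qed simp

lemma abs_log_bound_finite_disc:
  assumes f: "sph_holo f" and R: "0 < R" "R \<le> 1"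
    and fin: "\<And>z. z \<in> ball q R \<Longrightarrow> 1/2 \<le> sph_dist (f z) None"
    and \<eta>: "0 < \<eta>" "\<eta> \<le> sph_dist (f q) (Some 0)" and k: "4 < 3 ^ k * (\<eta> / 2)"
  shows "\<exists>as. length as \<le> k \<and> (\<forall>z\<in>ball q (R / 16) - set as.
    abs_log_abs (f z) \<le> ennreal (ln 4 + \<bar>ln ((\<eta> / 2) ^ 3 / 8\<^sup>2)\<bar> + (\<Sum>a\<leftarrow>as. max 0 (- ln (cmod (z - a))))))"
proof -
  \<comment> \<open>The scaling carries the disc of radius 2 required by
    \<open>lower_bound_by_zeros\<close> onto \<open>ball q R\<close>, and |w| < 1/8 onto
    \<open>ball q (R / 16)\<close>. As \<rho> <= 1, distances in z do not exceed those in w.\<close>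
  define \<rho> where "\<rho> = R / 2"
  have \<rho>: "0 < \<rho>" "\<rho> \<le> 1" "R = 2 * \<rho>" using R by (auto simp: \<rho>_def)
  define \<tau> where "\<tau> = (\<lambda>w. q + of_real \<rho> * w)"
  define F where "F = (\<lambda>w. the (f (\<tau> w)))"
  have \<tau>_ball: "\<tau> w \<in> ball q R" if "cmod w < 2" for w
    using that \<rho> by (simp add: \<tau>_def dist_norm norm_mult)
  have fF: "f (\<tau> w) = Some (F w) \<and> cmod (F w) \<le> 4" if "cmod w < 2" for w
    using cmod_le_of_sph_dist_inf[OF fin[OF \<tau>_ball[OF that]]] by (auto simp: F_def)
  have "((\<lambda>w. the (f w)) \<circ> \<tau>) holomorphic_on ball 0 2"
  proof (rule holomorphic_on_compose_gen[where t = "{z. f z \<noteq> None}"])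
    show "\<tau> holomorphic_on ball 0 2" unfolding \<tau>_def by (intro holomorphic_intros)
    show "\<tau> ` ball 0 2 \<subseteq> {z. f z \<noteq> None}" using fF by auto
  qed (use f in \<open>simp add: sph_holo_def\<close>)
  then have hol: "F holomorphic_on ball 0 2" by (simp add: F_def o_def)
  have F0: "\<eta> / 2 \<le> cmod (F 0)"
    using \<eta>(2) fF[of 0] sph_dist_zero_le[of "F 0"] by (simp add: \<tau>_def del: sph_dist.simps)
  obtain as where as: "length as \<le> k" and
    low: "\<And>w. cmod w < 1/8 \<Longrightarrow> (\<eta> / 2) ^ 3 / (2 * 4)\<^sup>2 * (\<Prod>a\<leftarrow>as. cmod (w - a)) \<le> cmod (F w)"
    using lower_bound_by_zeros[OF hol _ F0 _ k] fF \<eta>(1) by auto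
  define c where "c = (\<eta> / 2) ^ 3 / 8\<^sup>2"
  have c: "c > 0" using \<eta>(1) by (simp add: c_def)
  have "abs_log_abs (f z) \<le> ennreal (ln 4 + \<bar>ln c\<bar> + (\<Sum>a\<leftarrow>map \<tau> as. max 0 (- ln (cmod (z - a)))))"
    if z: "z \<in> ball q (R / 16) - set (map \<tau> as)" for z
  proof -
    define w where "w = (z - q) / of_real \<rho>"
    have zw: "z = \<tau> w" using \<rho> by (simp add: w_def \<tau>_def)
    have w: "cmod w < 1/8"
      using z \<rho> by (simp add: w_def norm_divide dist_norm norm_minus_commute field_simps)
    have d: "z - \<tau> a = of_real \<rho> * (w - a)" for a by (simp add: zw \<tau>_def algebra_simps)
    have le: "cmod (z - \<tau> a) \<le> cmod (w - a)" for a
      unfolding d norm_mult using \<rho> mult_left_le_one_le[of "cmod (w - a)" \<rho>] by simp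
    define S where "S = (\<Sum>a\<leftarrow>as. max 0 (- ln (cmod (z - \<tau> a))))"
    have S: "S \<ge> 0" unfolding S_def by (induction as) auto
    have "exp (- S) \<le> (\<Prod>a\<leftarrow>as. cmod (w - a))"
      unfolding S_def by (rule exp_neg_sum_le_prod) (use z le in auto)
    then have "c * exp (- S) \<le> c * (\<Prod>a\<leftarrow>as. cmod (w - a))"
      using c by (intro mult_left_mono) auto
    then have "c * exp (- S) \<le> cmod (F w)" using low[OF w] by (simp add: c_def)
    moreover have "c * exp (- S) > 0" using c by simp
    ultimately have nz: "cmod (F w) > 0" and "ln (c * exp (- S)) \<le> ln (cmod (F w))"
      by (linarith, subst ln_le_cancel_iff) auto
    then have "ln c - S \<le> ln (cmod (F w))" using c by (simp add: ln_mult)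
    moreover have l4: "0 \<le> ln (4::real)" by simp
    moreover have "ln (cmod (F w)) \<le> ln 4" using fF[of w] w nz by (subst ln_le_cancel_iff) auto
    ultimately have "\<bar>ln (cmod (F w))\<bar> \<le> ln 4 + \<bar>ln c\<bar> + S"
      using S l4 by linarith
    then show ?thesis using fF[of w] w nz by (simp add: zw[symmetric] S_def o_def ennreal_leI)
  qed
  then show ?thesis using as unfolding c_def by (intro exI[of _ "map \<tau> as"]) auto
qed

text \<open>The value at \<open>q\<close> has distance at least 1 from 0 or from infinity, and an
  oscillation below 1/2 leaves distance 1/2 on a whole disc; the previous estimate then applies to
  1/f or to f. The points of \<open>as\<close> are removed since the left side may be infinite there
  while \<open>ln 0\<close> is finite.\<close>

lemma N1_sym_local_log_bound:
  assumes f: "N1_sym f"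
  shows "\<exists>N C \<delta>. 0 < \<delta> \<and> \<delta> \<le> 1 \<and> 0 \<le> C \<and> (\<forall>p. \<exists>as. length as \<le> N \<and> (\<forall>z\<in>ball p \<delta> - set as.
    abs_log_abs (f z) \<le> ennreal (C + (\<Sum>a\<leftarrow>as. max 0 (- ln (cmod (z - a)))))))"
proof -
  obtain R0 where R0: "R0 > 0" "\<And>p z. dist z p < R0 \<Longrightarrow> sph_dist (f z) (f p) < 1/2"
    using N1_sym_equicontinuous[OF f, of "1/2"] by auto
  define R where "R = min 1 R0"
  have R: "0 < R" "R \<le> 1" and near: "\<And>z q. z \<in> ball q R \<Longrightarrow> sph_dist (f z) (f q) < 1/2"
    using R0 by (auto simp: R_def dist_commute)
  \<comment> \<open>With \<open>q\<close> within R/32 of \<open>p\<close>, the ball of radius R/32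
    about \<open>p\<close> lies in \<open>ball q (R / 16)\<close>.\<close>
  obtain \<eta> where \<eta>: "\<eta> > 0" "\<And>p. \<exists>q\<in>ball p (R / 32). \<eta> \<le> sph_dist (f q) (Some 0) \<and> \<eta> \<le> sph_dist (f q) None"
    using N1_sym_uniformly_nonconstant[OF f, of "R / 32"] R by auto
  obtain k where "8 / \<eta> < 3 ^ k" using real_arch_pow[of 3 "8 / \<eta>"] by auto
  then have k: "4 < 3 ^ k * (\<eta> / 2)" using \<eta>(1) by (simp add: field_simps)
  define C where "C = ln 4 + \<bar>ln ((\<eta> / 2) ^ 3 / 8\<^sup>2)\<bar>"
  have "\<exists>as. length as \<le> k \<and> (\<forall>z\<in>ball p (R / 32) - set as.
      abs_log_abs (f z) \<le> ennreal (C + (\<Sum>a\<leftarrow>as. max 0 (- ln (cmod (z - a))))))" for p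
  proof -
    obtain q where q: "q \<in> ball p (R / 32)" "\<eta> \<le> sph_dist (f q) (Some 0)" "\<eta> \<le> sph_dist (f q) None"
      using \<eta>(2) by blast
    have sub: "z \<in> ball q (R / 16)" if "z \<in> ball p (R / 32)" for z
      using that q(1) dist_triangle[of q z p] by (simp add: dist_commute)
    have zero: "sph_dist (sinv x) (Some 0) = sph_dist x None" and
      inf: "sph_dist (sinv x) None = sph_dist x (Some 0)" for x
      using sph_dist_sinv[of x None] sph_dist_sinv[of x "Some 0"] by simp_all
    have "1 \<le> sph_dist (f q) None \<or> 1 \<le> sph_dist (f q) (Some 0)"
      using sph_dist_zero_inf_le[of "f q"] by linarith
    then have "\<exists>as. length as \<le> k \<and> (\<forall>z\<in>ball q (R / 16) - set as.
      abs_log_abs (f z) \<le> ennreal (C + (\<Sum>a\<leftarrow>as. max 0 (- ln (cmod (z - a))))))"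
    proof
      assume *: "1 \<le> sph_dist (f q) None"
      have "1/2 \<le> sph_dist (f z) None" if "z \<in> ball q R" for z
        using near[OF that] * sph_dist_triangle[of "f q" None "f z"] sph_dist_commute[of "f q" "f z"] by linarith
      from abs_log_bound_finite_disc[of f R q, OF _ R this \<eta>(1) q(2) k] show ?thesis
        using f unfolding N1_sym_def C_def by blast
    next
      assume *: "1 \<le> sph_dist (f q) (Some 0)"
      have "1/2 \<le> sph_dist (sinv (f z)) None" if "z \<in> ball q R" for z
        unfolding inf
        using near[OF that] * sph_dist_triangle[of "f q" "Some 0" "f z"] sph_dist_commute[of "f q" "f z"] by linarith
      from abs_log_bound_finite_disc[of "\<lambda>z. sinv (f z)" R q, OF _ R this \<eta>(1) _ k] show ?thesis
        using f q(3) unfolding N1_sym_def C_def zero abs_log_abs_sinv by blast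
    qed
    then show ?thesis using sub by (meson Diff_iff)
  qed
  moreover have "C \<ge> 0" using ln_ge_zero[of 4] by (simp add: C_def)
  ultimately show ?thesis using R by (intro exI[of _ k] exI[of _ C] exI[of _ "R / 32"]) auto
qed

section \<open>Integration along arcs\<close>

lemma cmod_cis_diff: "cmod (cis a - cis b) = 2 * \<bar>sin ((a - b) / 2)\<bar>"
proof -
  have "cis a - cis b = cis b * (exp (\<i> * of_real (a - b)) - 1)"
    unfolding cis_conv_exp[symmetric] right_diff_distrib cis_mult by simp
  then show ?thesis by (simp only: norm_mult norm_cis dist_exp_i_1 mult_1)
qed

lemma cmod_cis_diff_le: "cmod (cis a - cis b) \<le> \<bar>a - b\<bar>"
  using abs_sin_x_le_abs_x[of "(a - b) / 2"] by (simp add: cmod_cis_diff)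

lemma cmod_cis_diff_ge:
  assumes "\<bar>a - b\<bar> \<le> 1"
  shows "\<bar>a - b\<bar> / 2 \<le> cmod (cis a - cis b)"
proof -
  define x where "x = (a - b) / 2"
  have x: "\<bar>x\<bar> \<le> 1" using assms by (simp add: x_def)
  \<comment> \<open>Taylor's formula gives |sin x| >= (5/6)|x| for |x| <= 1, more than the factor
    1/2 needed.\<close>
  have "\<bar>sin x - x\<bar> \<le> inverse 6 * \<bar>x\<bar> ^ 3"
    using Maclaurin_sin_bound[of x 3] by (simp add: eval_nat_numeral sin_coeff_def)
  moreover have "\<bar>x\<bar> ^ 3 \<le> \<bar>x\<bar>" using x power_decreasing[of 1 3 "\<bar>x\<bar>"] by simp
  ultimately have "\<bar>x\<bar> / 2 \<le> \<bar>sin x\<bar>" by (simp add: abs_if split: if_splits)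
  moreover have "\<bar>a - b\<bar> = 2 * \<bar>x\<bar>" by (simp add: x_def)
  ultimately show ?thesis unfolding cmod_cis_diff x_def[symmetric] by simp
qed

text \<open>The parameter of the arc point nearest to \<open>a\<close> serves as \<open>\<theta>0\<close>.\<close>
lemma arc_distance_lower_bound:
  assumes "\<alpha> \<le> \<beta>" "\<beta> - \<alpha> \<le> 1" "r > 0"
  obtains \<theta>0 where "\<theta>0 \<in> {\<alpha>..\<beta>}"
    "\<And>\<theta>. \<theta> \<in> {\<alpha>..\<beta>} \<Longrightarrow> r * \<bar>\<theta> - \<theta>0\<bar> / 4 \<le> cmod (c + of_real r * cis \<theta> - a)"
proof -
  define D where "D = (\<lambda>\<theta>. cmod (c + of_real r * cis \<theta> - a))"
  have "continuous_on {\<alpha>..\<beta>} D" unfolding D_def cis_conv_exp by (intro continuous_intros)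
  then obtain \<theta>0 where \<theta>0: "\<theta>0 \<in> {\<alpha>..\<beta>}" "\<And>\<theta>. \<theta> \<in> {\<alpha>..\<beta>} \<Longrightarrow> D \<theta>0 \<le> D \<theta>"
    using continuous_attains_inf[of "{\<alpha>..\<beta>}" D] assms(1) by auto
  have "r * \<bar>\<theta> - \<theta>0\<bar> / 4 \<le> D \<theta>" if \<theta>: "\<theta> \<in> {\<alpha>..\<beta>}" for \<theta>
  proof -
    have "\<bar>\<theta> - \<theta>0\<bar> \<le> 1" using \<theta> \<theta>0(1) assms(2) by auto
    then have "r * (\<bar>\<theta> - \<theta>0\<bar> / 2) \<le> r * cmod (cis \<theta> - cis \<theta>0)"
      using assms(3) by (intro mult_left_mono cmod_cis_diff_ge) auto
    also have "\<dots> = cmod (of_real r * (cis \<theta> - cis \<theta>0))" using assms(3) by (simp add: norm_mult)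
    also have "of_real r * (cis \<theta> - cis \<theta>0)
        = (c + of_real r * cis \<theta> - a) - (c + of_real r * cis \<theta>0 - a)" by (simp add: algebra_simps)
    \<comment> \<open>\<open>a\<close> may lie off the circle: the chord from \<theta>0 to \<theta>
      is at most the sum of both distances to \<open>a\<close>, and \<theta>0 minimises the
      distance. This halves the 1/2 of the chord estimate to 1/4.\<close>
    also have "cmod \<dots> \<le> D \<theta> + D \<theta>0" unfolding D_def by (rule norm_triangle_ineq4)
    also have "\<dots> \<le> 2 * D \<theta>" using \<theta>0(2)[OF \<theta>] by simp
    finally show ?thesis by simp
  qed
  then show ?thesis using that \<theta>0(1) unfolding D_def by blast
qed

lemma nn_integral_powr_neg_half_le:
  assumes "L > 0"
  shows "(\<integral>\<^sup>+x\<in>{t - L..t + L}. ennreal (\<bar>x - t\<bar> powr (- 1/2)) \<partial>lborel) \<le> ennreal (4 * sqrt L)"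
proof -
  define p where "p = (\<lambda>x::real. ennreal (indicator {0..L} x * x powr (- 1/2)))"
  have [measurable]: "p \<in> borel_measurable borel" unfolding p_def by measurable
  have "((\<lambda>x. x powr (- 1/2)) has_integral (L powr (- 1/2 + 1) / (- 1/2 + 1))) {0..L}"
    using assms by (intro has_integral_powr_from_0) auto
  then have "((\<lambda>x. x powr (- 1/2)) has_integral 2 * sqrt L) {0..L}"
    using assms by (simp add: powr_half_sqrt mult.commute)
  then have ip: "integral\<^sup>N lborel p = ennreal (2 * sqrt L)"
    unfolding p_def by (intro nn_integral_has_integral_lebesgue) auto
  \<comment> \<open>The interval is folded at \<open>t\<close>: one copy of \<open>p\<close> covers
    each side, in the affine form that the substitution rule expects.\<close>
  have "(\<integral>\<^sup>+x\<in>{t - L..t + L}. ennreal (\<bar>x - t\<bar> powr (- 1/2)) \<partial>lborel)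
      \<le> (\<integral>\<^sup>+x. p (- t + 1 * x) + p (t + (- 1) * x) \<partial>lborel)"
    by (intro nn_integral_mono) (auto simp: p_def indicator_def abs_if)
  also have "\<dots> = (\<integral>\<^sup>+x. p (- t + 1 * x) \<partial>lborel) + (\<integral>\<^sup>+x. p (t + (- 1) * x) \<partial>lborel)"
    by (intro nn_integral_add) auto
  also have "\<dots> = ennreal (2 * sqrt L) + ennreal (2 * sqrt L)"
    using nn_integral_real_affine[of p 1 "- t"] nn_integral_real_affine[of p "- 1" t]
    by (simp add: ip)
  also have "\<dots> = ennreal (4 * sqrt L)" using assms by (simp add: ennreal_plus[symmetric] del: ennreal_plus)
  finally show ?thesis .
qed

text \<open>From -ln(x/4) = 2 ln(2/sqrt x) and ln s <= s - 1. Unlike the logarithm, the power is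
  multiplicative, so a factor r in x can be pulled out of the integral.\<close>

lemma neg_log_le_powr:
  fixes x y :: real
  assumes "0 < x" "x / 4 \<le> y"
  shows "max 0 (- ln y) \<le> 4 * x powr (- 1/2)"
proof -
  have "- ln y \<le> - ln (x / 4)" using assms by (subst neg_le_iff_le, subst ln_le_cancel_iff) auto
  also have "\<dots> = 2 * ln (2 / sqrt x)" using assms by (simp add: ln_div ln_sqrt ln_realpow[of 2 2, simplified])
  also have "\<dots> \<le> 2 * (2 / sqrt x - 1)" using assms by (intro mult_left_mono ln_le_minus_one) auto
  also have "\<dots> \<le> 4 * x powr (- 1/2)"
    using assms by (simp add: powr_minus powr_half_sqrt field_simps)
  finally show ?thesis using assms by simp
qed

lemma borel_measurable_arc_log [measurable]:
  "(\<lambda>\<theta>. max 0 (- ln (cmod (c + of_real r * cis \<theta> - a)))) \<in> borel_measurable borel"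
proof -
  have [measurable]: "(\<lambda>\<theta>. cmod (c + of_real r * cis \<theta> - a)) \<in> borel_measurable borel"
    unfolding cis_conv_exp by (intro borel_measurable_continuous_onI continuous_intros)
  show ?thesis by measurable
qed

text \<open>The integrand is at most 4 (r |\<theta> - \<theta>0|)^(-1/2) on |\<theta> - \<theta>0|
  <= 1/r, so its integral is at most (4/sqrt r)(4/sqrt r) = 16/r, wherever \<open>a\<close> lies.
  The same distance bound shows that only \<theta>0 can hit \<open>a\<close>.\<close>

lemma arc_log_integral_le:
  assumes "\<alpha> \<le> \<beta>" "r * (\<beta> - \<alpha>) \<le> 1" "r \<ge> 1"
  shows "(\<integral>\<^sup>+\<theta>\<in>{\<alpha>..\<beta>}. ennreal (max 0 (- ln (cmod (c + of_real r * cis \<theta> - a)))) \<partial>lborel)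
           \<le> ennreal (16 / r)"
    and "AE \<theta> in lborel. \<theta> \<in> {\<alpha>..\<beta>} \<longrightarrow> c + of_real r * cis \<theta> \<noteq> a"
proof -
  have "1 * (\<beta> - \<alpha>) \<le> r * (\<beta> - \<alpha>)" using assms by (intro mult_right_mono) auto
  then have len: "\<beta> - \<alpha> \<le> 1" using assms(2) by simp
  obtain \<theta>0 where \<theta>0: "\<theta>0 \<in> {\<alpha>..\<beta>}"
    "\<And>\<theta>. \<theta> \<in> {\<alpha>..\<beta>} \<Longrightarrow> r * \<bar>\<theta> - \<theta>0\<bar> / 4 \<le> cmod (c + of_real r * cis \<theta> - a)"
    using arc_distance_lower_bound[OF assms(1) len] assms(3) by (metis less_le_trans zero_less_one)
  have ae: "AE \<theta> in lborel. \<theta> \<noteq> \<theta>0" by (rule AE_lborel_singleton)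
  then show "AE \<theta> in lborel. \<theta> \<in> {\<alpha>..\<beta>} \<longrightarrow> c + of_real r * cis \<theta> \<noteq> a"
  proof eventually_elim
    case (elim \<theta>)
    show ?case
    proof
      assume "\<theta> \<in> {\<alpha>..\<beta>}"
      from \<theta>0(2)[OF this] elim assms(3) show "c + of_real r * cis \<theta> \<noteq> a"
        by (auto simp: zero_less_mult_iff mult_le_0_iff)
    qed
  qed
  have pt: "max 0 (- ln (cmod (c + of_real r * cis \<theta> - a)))
      \<le> 4 / sqrt r * \<bar>\<theta> - \<theta>0\<bar> powr (- 1/2)" "\<bar>\<theta> - \<theta>0\<bar> \<le> 1 / r"
    if "\<theta> \<in> {\<alpha>..\<beta>}" "\<theta> \<noteq> \<theta>0" for \<theta>
  proof -
    have "\<bar>\<theta> - \<theta>0\<bar> \<le> \<beta> - \<alpha>" using that \<theta>0(1) by auto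
    then have "r * \<bar>\<theta> - \<theta>0\<bar> \<le> r * (\<beta> - \<alpha>)" using assms(3) by (intro mult_left_mono) auto
    then have le1: "r * \<bar>\<theta> - \<theta>0\<bar> \<le> 1" using assms(2) by linarith
    then show "\<bar>\<theta> - \<theta>0\<bar> \<le> 1 / r" using assms(3) by (simp add: field_simps)
    have "max 0 (- ln (cmod (c + of_real r * cis \<theta> - a))) \<le> 4 * (r * \<bar>\<theta> - \<theta>0\<bar>) powr (- 1/2)"
      using that assms(3) \<theta>0(2) by (intro neg_log_le_powr) auto
    also have "(r * \<bar>\<theta> - \<theta>0\<bar>) powr (- 1/2) = r powr (- 1/2) * \<bar>\<theta> - \<theta>0\<bar> powr (- 1/2)"
      by (rule powr_mult)
    also have "r powr (- 1/2) = 1 / sqrt r" using assms(3) by (simp add: powr_minus powr_half_sqrt field_simps)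
    finally show "max 0 (- ln (cmod (c + of_real r * cis \<theta> - a))) \<le> 4 / sqrt r * \<bar>\<theta> - \<theta>0\<bar> powr (- 1/2)"
      by simp
  qed
  have "(\<integral>\<^sup>+\<theta>\<in>{\<alpha>..\<beta>}. ennreal (max 0 (- ln (cmod (c + of_real r * cis \<theta> - a)))) \<partial>lborel)
      \<le> (\<integral>\<^sup>+\<theta>. ennreal (4 / sqrt r) *
            (ennreal (\<bar>\<theta> - \<theta>0\<bar> powr (- 1/2)) * indicator {\<theta>0 - 1 / r..\<theta>0 + 1 / r} \<theta>) \<partial>lborel)"
  proof (rule nn_integral_mono_AE)
    show "AE \<theta> in lborel. ennreal (max 0 (- ln (cmod (c + of_real r * cis \<theta> - a)))) * indicator {\<alpha>..\<beta>} \<theta>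
      \<le> ennreal (4 / sqrt r) *
            (ennreal (\<bar>\<theta> - \<theta>0\<bar> powr (- 1/2)) * indicator {\<theta>0 - 1 / r..\<theta>0 + 1 / r} \<theta>)"
      using ae
    proof eventually_elim
      case (elim \<theta>)
      show ?case
      proof (cases "\<theta> \<in> {\<alpha>..\<beta>}")
        case True
        then have "\<theta> \<in> {\<theta>0 - 1 / r..\<theta>0 + 1 / r}" using pt(2)[OF True elim] by (auto simp: abs_le_iff)
        then show ?thesis
          using True ennreal_leI[OF pt(1)[OF True elim]] assms(3) by (simp add: ennreal_mult[symmetric])
      qed simp
    qed
  qed
  also have "\<dots> = ennreal (4 / sqrt r) *
      (\<integral>\<^sup>+\<theta>\<in>{\<theta>0 - 1 / r..\<theta>0 + 1 / r}. ennreal (\<bar>\<theta> - \<theta>0\<bar> powr (- 1/2)) \<partial>lborel)"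
    by (rule nn_integral_cmult) measurable
  also have "\<dots> \<le> ennreal (4 / sqrt r) * ennreal (4 * sqrt (1 / r))"
    using assms(3) by (intro mult_left_mono nn_integral_powr_neg_half_le) auto
  also have "\<dots> = ennreal (16 / r)"
    using assms(3) by (simp add: ennreal_mult[symmetric] real_sqrt_divide)
  finally show "(\<integral>\<^sup>+\<theta>\<in>{\<alpha>..\<beta>}. ennreal (max 0 (- ln (cmod (c + of_real r * cis \<theta> - a)))) \<partial>lborel)
           \<le> ennreal (16 / r)" .
qed

text \<open>Measurability is carried through the induction because splitting off one logarithm
  requires it of the remaining sum.\<close>

lemma arc_log_sum_integral_le:
  assumes "\<alpha> \<le> \<beta>" "r * (\<beta> - \<alpha>) \<le> 1" "r \<ge> 1" "C \<ge> 0"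
  shows "(\<lambda>\<theta>. ennreal (C + (\<Sum>a\<leftarrow>as. max 0 (- ln (cmod (c + of_real r * cis \<theta> - a)))))) \<in> borel_measurable borel \<and>
    (\<integral>\<^sup>+\<theta>\<in>{\<alpha>..\<beta>}. ennreal (C + (\<Sum>a\<leftarrow>as. max 0 (- ln (cmod (c + of_real r * cis \<theta> - a))))) \<partial>lborel)
           \<le> ennreal ((C + 16 * real (length as)) / r)"
proof (induction as)
  case Nil
  have "(\<integral>\<^sup>+\<theta>\<in>{\<alpha>..\<beta>}. ennreal C \<partial>lborel) = ennreal (C * (\<beta> - \<alpha>))"
    using assms by (simp add: nn_integral_cmult_indicator ennreal_mult)
  also have "\<dots> \<le> ennreal (C * (1 / r))"
    using assms by (intro ennreal_leI mult_left_mono) (auto simp: field_simps)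
  finally show ?case by simp
next
  case (Cons a as)
  define g where "g = (\<lambda>\<theta>. ennreal (C + (\<Sum>a\<leftarrow>as. max 0 (- ln (cmod (c + of_real r * cis \<theta> - a))))))"
  define m where "m = (\<lambda>\<theta>. ennreal (max 0 (- ln (cmod (c + of_real r * cis \<theta> - a)))))"
  have [measurable]: "g \<in> borel_measurable borel" "m \<in> borel_measurable borel"
    using Cons by (auto simp: g_def m_def)
  have eq: "ennreal (C + (\<Sum>a\<leftarrow>a # as. max 0 (- ln (cmod (c + of_real r * cis \<theta> - a)))))
      = m \<theta> + g \<theta>" for \<theta>
  proof -
    have "0 \<le> (\<Sum>a\<leftarrow>as. max 0 (- ln (cmod (c + of_real r * cis \<theta> - a))))" by (induction as) auto
    then show ?thesis
      unfolding m_def g_def using assms(4) by (subst ennreal_plus[symmetric]) (auto simp: algebra_simps)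
  qed
  have "(\<integral>\<^sup>+\<theta>\<in>{\<alpha>..\<beta>}. (m \<theta> + g \<theta>) \<partial>lborel)
      = (\<integral>\<^sup>+\<theta>\<in>{\<alpha>..\<beta>}. m \<theta> \<partial>lborel) + (\<integral>\<^sup>+\<theta>\<in>{\<alpha>..\<beta>}. g \<theta> \<partial>lborel)"
    unfolding distrib_right by (rule nn_integral_add) measurable
  also have "\<dots> \<le> ennreal (16 / r) + ennreal ((C + 16 * real (length as)) / r)"
    using Cons arc_log_integral_le(1)[OF assms(1-3)] unfolding m_def g_def by (intro add_mono) auto
  also have "\<dots> = ennreal ((C + 16 * real (length (a # as))) / r)"
    using assms by (subst ennreal_plus[symmetric]) (auto simp: field_simps)
  finally show ?case unfolding eq by simp
qed

theorem mainTheorem16: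
  fixes f :: "complex \<Rightarrow> complex option"
  assumes "N1 f"
  shows "\<exists>C::real. \<forall>c::complex. \<forall>r::real. r > 1 \<longrightarrow>
           (\<integral>\<^sup>+ \<theta>\<in>{0..2*pi}. abs_log_abs (f (c + of_real r * cis \<theta>)) \<partial>lborel) < ennreal C"
proof -
  obtain N C \<delta> where \<delta>: "0 < \<delta>" "\<delta> \<le> 1" and C: "0 \<le> C" and
    loc: "\<And>p. \<exists>as. length as \<le> N \<and> (\<forall>z\<in>ball p \<delta> - set as.
      abs_log_abs (f z) \<le> ennreal (C + (\<Sum>a\<leftarrow>as. max 0 (- ln (cmod (z - a))))))"
    using N1_sym_local_log_bound[OF N1_imp_N1_sym[OF assms]] by metis
  \<comment> \<open>For r > 1 there are at most (4 pi/\<delta> + 2) r arcs, each contributing at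
    most (C + 16 N)/r.\<close>
  define B where "B = (4 * pi / \<delta> + 2) * (C + 16 * real N)"
  have "(\<integral>\<^sup>+ \<theta>\<in>{0..2*pi}. abs_log_abs (f (c + of_real r * cis \<theta>)) \<partial>lborel) \<le> ennreal B"
    if r: "r > 1" for c r
  proof -
    define z where "z = (\<lambda>\<theta>. c + of_real r * cis \<theta>)"
    \<comment> \<open>This many arcs make the arc length r L at most \<delta>/2, so each arc lies in
      the disc of radius \<delta> about its starting point.\<close>
    define m where "m = nat \<lceil>4 * pi * r / \<delta>\<rceil>"
    have quot: "4 * pi * r / \<delta> > 0" using r \<delta> by simp
    have m_ge: "4 * pi * r / \<delta> \<le> real m" unfolding m_def using quot by linarith
    have m_le: "real m \<le> 4 * pi * r / \<delta> + 1" unfolding m_def using quot by linarith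
    have m0: "real m > 0" using m_ge quot by linarith
    define L where "L = 2 * pi / real m"
    have L: "L > 0" using m0 by (simp add: L_def)
    have rL: "r * L \<le> \<delta> / 2" using m_ge m0 \<delta> unfolding L_def by (simp add: field_simps)
    define I where "I = (\<lambda>i. {real i * L..real i * L + L})"
    \<comment> \<open>Sum and integral are interchanged for the measurable majorants
      \<open>g i\<close>, not for the integrand itself; the latter enters only through an inequality
      almost everywhere.\<close>
    define P where "P = (\<lambda>i g. g \<in> borel_measurable borel \<and>
        (AE \<theta> in lborel. \<theta> \<in> I i \<longrightarrow> abs_log_abs (f (z \<theta>)) \<le> g \<theta>) \<and>
        (\<integral>\<^sup>+\<theta>\<in>I i. g \<theta> \<partial>lborel) \<le> ennreal ((C + 16 * real N) / r))"
    have "\<exists>g. P i g" for i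
    proof -
      obtain as where as: "length as \<le> N" and
        bd: "\<And>w. w \<in> ball (z (real i * L)) \<delta> \<Longrightarrow> w \<notin> set as \<Longrightarrow>
          abs_log_abs (f w) \<le> ennreal (C + (\<Sum>a\<leftarrow>as. max 0 (- ln (cmod (w - a)))))"
        using loc[of "z (real i * L)"] by blast
      have cond: "real i * L \<le> real i * L + L" "r * (real i * L + L - real i * L) \<le> 1" "r \<ge> 1"
        using L rL \<delta> r by auto
      define g where "g = (\<lambda>\<theta>. ennreal (C + (\<Sum>a\<leftarrow>as. max 0 (- ln (cmod (z \<theta> - a))))))"
      have "AE \<theta> in lborel. \<forall>a\<in>set as. \<theta> \<in> I i \<longrightarrow> z \<theta> \<noteq> a"
        unfolding I_def z_def using arc_log_integral_le(2)[OF cond] by (subst AE_finite_all) auto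
      then have "AE \<theta> in lborel. \<theta> \<in> I i \<longrightarrow> abs_log_abs (f (z \<theta>)) \<le> g \<theta>"
      proof eventually_elim
        case (elim \<theta>)
        show ?case
        proof
          assume \<theta>: "\<theta> \<in> I i"
          have "dist (z (real i * L)) (z \<theta>) = r * cmod (cis (real i * L) - cis \<theta>)"
            using r unfolding z_def dist_norm
            by (simp add: norm_mult right_diff_distrib[symmetric])
          also have "\<dots> \<le> r * \<bar>real i * L - \<theta>\<bar>"
            using r by (intro mult_left_mono cmod_cis_diff_le) auto
          also have "\<dots> \<le> r * L" using \<theta> r by (intro mult_left_mono) (auto simp: I_def)
          also have "\<dots> < \<delta>" using rL \<delta> by simp
          finally show "abs_log_abs (f (z \<theta>)) \<le> g \<theta>"
            unfolding g_def by (intro bd) (use elim \<theta> in auto)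
        qed
      qed
      moreover have "g \<in> borel_measurable borel" and
        "(\<integral>\<^sup>+\<theta>\<in>I i. g \<theta> \<partial>lborel) \<le> ennreal ((C + 16 * real (length as)) / r)"
        using arc_log_sum_integral_le[OF cond C, where as = as and c = c] unfolding g_def I_def z_def by auto
      moreover have "ennreal ((C + 16 * real (length as)) / r) \<le> ennreal ((C + 16 * real N) / r)"
        using as r by (intro ennreal_leI divide_right_mono) auto
      ultimately have "P i g" unfolding P_def by (meson order_trans)
      then show "\<exists>g. P i g" by (rule exI[of _ g])
    qed
    then obtain g where P: "\<And>i. P i (g i)" by metis
    have [measurable]: "\<And>i. g i \<in> borel_measurable borel" and
      ae: "\<And>i. AE \<theta> in lborel. \<theta> \<in> I i \<longrightarrow> abs_log_abs (f (z \<theta>)) \<le> g i \<theta>" and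
      int: "\<And>i. (\<integral>\<^sup>+\<theta>\<in>I i. g i \<theta> \<partial>lborel) \<le> ennreal ((C + 16 * real N) / r)"
      using P unfolding P_def by blast+
    have [measurable]: "I i \<in> sets borel" for i by (simp add: I_def)
    \<comment> \<open>The index m is included because \<theta> = 2 pi yields i = m. Overlaps of the
      closed arcs are harmless for an upper bound.\<close>
    have cover: "\<exists>i\<le>m. \<theta> \<in> I i" if "\<theta> \<in> {0..2*pi}" for \<theta>
    proof -
      define i where "i = nat \<lfloor>\<theta> / L\<rfloor>"
      have nn: "0 \<le> \<theta> / L" using that L by simp
      have "\<theta> / L \<le> real m" using that L m0 by (simp add: L_def field_simps)
      then have "i \<le> m" unfolding i_def using nn by linarith
      moreover have "real i \<le> \<theta> / L" "\<theta> / L \<le> real i + 1" unfolding i_def using nn by linarith+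
      then have "\<theta> \<in> I i" using L by (simp add: I_def field_simps)
      ultimately show ?thesis by blast
    qed
    have "(\<integral>\<^sup>+ \<theta>\<in>{0..2*pi}. abs_log_abs (f (z \<theta>)) \<partial>lborel)
        \<le> (\<integral>\<^sup>+ \<theta>. (\<Sum>i\<le>m. g i \<theta> * indicator (I i) \<theta>) \<partial>lborel)"
    proof (rule nn_integral_mono_AE)
      have "AE \<theta> in lborel. \<forall>i. \<theta> \<in> I i \<longrightarrow> abs_log_abs (f (z \<theta>)) \<le> g i \<theta>"
        unfolding AE_all_countable using ae by blast
      then show "AE \<theta> in lborel. abs_log_abs (f (z \<theta>)) * indicator {0..2*pi} \<theta>
          \<le> (\<Sum>i\<le>m. g i \<theta> * indicator (I i) \<theta>)"
      proof eventually_elim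
        case (elim \<theta>)
        show ?case
        proof (cases "\<theta> \<in> {0..2*pi}")
          case True
          then obtain i where i: "i \<le> m" "\<theta> \<in> I i" using cover by blast
          have "abs_log_abs (f (z \<theta>)) * indicator {0..2*pi} \<theta> \<le> g i \<theta> * indicator (I i) \<theta>"
            using elim i True by simp
          also have "\<dots> \<le> (\<Sum>i\<le>m. g i \<theta> * indicator (I i) \<theta>)"
            by (rule member_le_sum) (use i in auto)
          finally show ?thesis .
        qed simp
      qed
    qed
    also have "\<dots> = (\<Sum>i\<le>m. \<integral>\<^sup>+\<theta>\<in>I i. g i \<theta> \<partial>lborel)"
      by (rule nn_integral_sum) measurable
    also have "\<dots> \<le> (\<Sum>i\<le>m. ennreal ((C + 16 * real N) / r))" by (intro sum_mono int)
    also have "\<dots> = ennreal (real (Suc m)) * ennreal ((C + 16 * real N) / r)"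
      by (simp add: ennreal_of_nat_eq_real_of_nat del: of_nat_Suc)
    also have "\<dots> = ennreal (real (Suc m) * ((C + 16 * real N) / r))"
      using C r by (intro ennreal_mult[symmetric]) auto
    also have "\<dots> \<le> ennreal B"
    proof (rule ennreal_leI)
      have "real (Suc m) \<le> (4 * pi / \<delta> + 2) * r" using m_le r by (simp add: field_simps)
      then have "real (Suc m) * ((C + 16 * real N) / r) \<le> (4 * pi / \<delta> + 2) * r * ((C + 16 * real N) / r)"
        using C r by (intro mult_right_mono) auto
      also have "\<dots> = B" unfolding B_def using r by simp
      finally show "real (Suc m) * ((C + 16 * real N) / r) \<le> B" .
    qed
    finally show ?thesis unfolding z_def .
  qed
  moreover have "0 \<le> B" using C \<delta> by (simp add: B_def)
  then have "ennreal B < ennreal (B + 1)" by (intro ennreal_lessI) auto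
  ultimately show ?thesis by (meson le_less_trans)
qed

end
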